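(* Let $X\subseteq S^1$ and $0<r<\frac12$. Define $$T_r(X)=\tfrac{1}{1+2r}X\ \cup\ \Big(\tfrac{1}{1+2r}\big(X\cap[0,2r)_{S^1}\big)+\tfrac{1}{1+2r}\Big),$$ and let $\pi_r:S^1\to S^1$ be the (non-continuous) map $\pi_r(y)=(1+2r)y\bmod 1$ for $y\in[0,1)$. Then $\pi_r$ maps $T_r(X)$ onto $X$ and induces a simplicial map $$\pi_r:\mathbf{VR}_{\le}\Big(T_r(X);\tfrac{2r}{1+2r}\Big)\to\check{\mathbf C}_{\le}(X;r)$$ which is a homotopy equivalence.
   Context: $S^1$ is the circle of circumference $1$ with the arc-length metric; each point is identified with a number in $[0,1)$, and for $X\subseteq S^1$ and $a,b\in\mathbb R$, $aX+b=\{(ax+b)\bmod 1: x\in X\}$ with $x$ represented in $[0,1)$. $[0,2r)_{S^1}$ is the half-open clockwise arc from $0$ to $2r$. $\mathbf{VR}_{\le}(Y;s)$ is the Vietoris–Rips complex: vertex set $Y$, faces the finite subsets of diameter at most $s$. $\check{\mathbf C}_{\le}(X;r)$ is the Čech complex: vertex set $X$, and a finite $\sigma\subseteq X$ is a face iff the closed balls of radius $r$ in $S^1$ about the points of $\sigma$ have a common point (equivalently $\sigma$ lies in a closed arc of length $2r$). Complexes carry the CW (weak) topology. *)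

theory Defs
  imports "HOL-Analysis.Analysis"
begin

text \<open>The circle S^1 of circumference 1, points represented by reals in [0,1).\<close>
definition S1 :: "real set" where
  "S1 = {0..<1}"

definition s1_dist :: "real \<Rightarrow> real \<Rightarrow> real" where
  "s1_dist x y = min \<bar>x - y\<bar> (1 - \<bar>x - y\<bar>)"

definition s1_affine :: "real \<Rightarrow> real \<Rightarrow> real set \<Rightarrow> real set" where
  "s1_affine a b X = (\<lambda>x. frac (a * x + b)) ` X"

definition s1_arc0 :: "real \<Rightarrow> real set" where
  "s1_arc0 t = {x \<in> S1. x < t}"

definition T_r :: "real \<Rightarrow> real set \<Rightarrow> real set" where
  "T_r r X = s1_affine (1 / (1 + 2*r)) 0 X
           \<union> s1_affine (1 / (1 + 2*r)) (1 / (1 + 2*r)) (X \<inter> s1_arc0 (2*r))"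

definition pi_r :: "real \<Rightarrow> real \<Rightarrow> real" where
  "pi_r r y = frac ((1 + 2*r) * y)"

text \<open>Simplicial complexes are given by their (nonempty, finite) faces.\<close>
definition VR_le :: "real set \<Rightarrow> real \<Rightarrow> real set set" where
  "VR_le Y s = {\<sigma>. \<sigma> \<subseteq> Y \<and> finite \<sigma> \<and> \<sigma> \<noteq> {} \<and> (\<forall>x\<in>\<sigma>. \<forall>y\<in>\<sigma>. s1_dist x y \<le> s)}"

definition Cech_le :: "real set \<Rightarrow> real \<Rightarrow> real set set" where
  "Cech_le X r = {\<sigma>. \<sigma> \<subseteq> X \<and> finite \<sigma> \<and> \<sigma> \<noteq> {} \<and>
                      (\<exists>p\<in>S1. \<forall>x\<in>\<sigma>. s1_dist x p \<le> r)}"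

definition simplicial_map :: "'a set set \<Rightarrow> 'b set set \<Rightarrow> ('a \<Rightarrow> 'b) \<Rightarrow> bool" where
  "simplicial_map K L f \<longleftrightarrow> (\<forall>\<sigma>\<in>K. f ` \<sigma> \<in> L)"

text \<open>Closed geometric simplex of a finite vertex set, as finitely supported
  barycentric-coordinate functions.\<close>
definition geo_simplex :: "'a set \<Rightarrow> ('a \<Rightarrow> real) set" where
  "geo_simplex \<sigma> = {g. (\<forall>v. g v \<ge> 0) \<and> (\<forall>v. v \<notin> \<sigma> \<longrightarrow> g v = 0) \<and> sum g \<sigma> = 1}"

text \<open>Geometric realization with the CW (weak/coherent) topology: a set is open iff its
  intersection with every closed simplex is open in that (Euclidean) simplex.\<close>
definition realization :: "'a set set \<Rightarrow> ('a \<Rightarrow> real) topology" where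
  "realization K = topology (\<lambda>U. U \<subseteq> (\<Union>\<sigma>\<in>K. geo_simplex \<sigma>) \<and>
      (\<forall>\<sigma>\<in>K. openin (subtopology euclidean (geo_simplex \<sigma>)) (U \<inter> geo_simplex \<sigma>)))"

definition induced_map :: "('a \<Rightarrow> 'b) \<Rightarrow> ('a \<Rightarrow> real) \<Rightarrow> ('b \<Rightarrow> real)" where
  "induced_map f g = (\<lambda>w. \<Sum>v\<in>{v. g v \<noteq> 0 \<and> f v = w}. g v)"

definition homotopy_equivalence ::
  "'a topology \<Rightarrow> 'b topology \<Rightarrow> ('a \<Rightarrow> 'b) \<Rightarrow> bool" where
  "homotopy_equivalence A B f \<longleftrightarrow> continuous_map A B f \<and>
     (\<exists>g. continuous_map B A g \<and> homotopic_with (\<lambda>x. True) A A (g \<circ> f) id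
          \<and> homotopic_with (\<lambda>x. True) B B (f \<circ> g) id)"

end

theory Submission
  imports Defs
begin

text \<open>
  Stretching the circle by \<open>1 + 2 * r\<close> turns \<open>T_r r X\<close> into X together with a copy of its initial
  part shifted by 1, two of its points being adjacent iff they differ by at most \<open>2 * r\<close> or at
  least 1. A homotopy inverse of the projection is defined on the barycentric subdivision of the
  Cech complex: a face \<open>\<tau>\<close> goes to a suitable lift \<open>\<phi> \<tau>\<close> of the first point of an arc
  containing \<open>\<tau>\<close>. Nested faces have adjacent lifts, and the Vietoris--Rips complex is determined
  by its edges, so this is simplicial. One composite is joined to the identity by straight lines.
  The other is homotopic to the map given by \<open>\<phi> (\<pi> ` \<sigma>)\<close> on faces \<open>\<sigma>\<close>, hence, because
  \<open>\<phi> (\<pi> ` \<sigma>)\<close> is adjacent to \<open>Min \<sigma>'\<close> whenever \<open>\<sigma> \<subseteq> \<sigma>'\<close>, to the map given by \<open>Min\<close>, and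
  hence to the identity.
\<close>

section \<open>Weak topology and homotopies\<close>

definition spt :: "('a \<Rightarrow> real) \<Rightarrow> 'a set" where
  "spt g = {v. g v \<noteq> 0}"

definition complex_on :: "'a set set \<Rightarrow> bool" where
  "complex_on K \<longleftrightarrow> (\<forall>\<sigma>\<in>K. finite \<sigma> \<and> \<sigma> \<noteq> {} \<and> (\<forall>\<tau>. \<tau> \<subseteq> \<sigma> \<longrightarrow> \<tau> \<noteq> {} \<longrightarrow> \<tau> \<in> K))"

definition complex_space :: "'a set set \<Rightarrow> ('a \<Rightarrow> real) set" where
  "complex_space K = (\<Union>\<sigma>\<in>K. geo_simplex \<sigma>)"

lemma complex_onD:
  assumes "complex_on K" "\<sigma> \<in> K"
  shows "finite \<sigma>" "\<sigma> \<noteq> {}" "\<And>\<tau>. \<tau> \<subseteq> \<sigma> \<Longrightarrow> \<tau> \<noteq> {} \<Longrightarrow> \<tau> \<in> K"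
  using assms unfolding complex_on_def by blast+

lemma geo_simplex_nonneg: "g \<in> geo_simplex \<sigma> \<Longrightarrow> 0 \<le> g v"
  by (simp add: geo_simplex_def)

lemma spt_geo_simplex:
  assumes "g \<in> geo_simplex \<sigma>"
  shows "spt g \<subseteq> \<sigma>" "spt g \<noteq> {}"
proof -
  show "spt g \<subseteq> \<sigma>"
    using assms by (auto simp: geo_simplex_def spt_def)
  show "spt g \<noteq> {}"
  proof
    assume "spt g = {}"
    then have "sum g \<sigma> = 0"
      by (auto simp: spt_def intro: sum.neutral)
    then show False
      using assms by (simp add: geo_simplex_def)
  qed
qed

lemma sum_eq_sum_spt:
  assumes "finite B" "spt g \<subseteq> B"
  shows "sum g B = sum g (spt g)"
  using assms by (intro sum.mono_neutral_right) (auto simp: spt_def)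

text \<open>The support is the smallest face carrying a point, so membership can be tested on it
  without choosing a simplex.\<close>

lemma complex_space_iff:
  assumes "complex_on K"
  shows "g \<in> complex_space K \<longleftrightarrow> (\<forall>v. 0 \<le> g v) \<and> spt g \<in> K \<and> sum g (spt g) = 1"
proof
  assume "g \<in> complex_space K"
  then obtain \<sigma> where \<sigma>: "\<sigma> \<in> K" "g \<in> geo_simplex \<sigma>"
    by (auto simp: complex_space_def)
  with complex_onD[OF assms] spt_geo_simplex[OF \<sigma>(2)] have "spt g \<in> K"
    by blast
  moreover have "sum g (spt g) = 1"
    using \<sigma> complex_onD(1)[OF assms] spt_geo_simplex[OF \<sigma>(2)] sum_eq_sum_spt[of \<sigma> g]
    by (auto simp: geo_simplex_def)
  ultimately show "(\<forall>v. 0 \<le> g v) \<and> spt g \<in> K \<and> sum g (spt g) = 1"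
    using \<sigma> by (auto simp: geo_simplex_def)
next
  assume "(\<forall>v. 0 \<le> g v) \<and> spt g \<in> K \<and> sum g (spt g) = 1"
  then have "g \<in> geo_simplex (spt g)" "spt g \<in> K"
    by (auto simp: geo_simplex_def spt_def)
  then show "g \<in> complex_space K"
    by (auto simp: complex_space_def)
qed

lemma openin_realization:
  "openin (realization K) U \<longleftrightarrow> U \<subseteq> complex_space K \<and>
     (\<forall>\<sigma>\<in>K. openin (top_of_set (geo_simplex \<sigma>)) (U \<inter> geo_simplex \<sigma>))"
proof -
  have "istopology (\<lambda>U. U \<subseteq> complex_space K \<and>
      (\<forall>\<sigma>\<in>K. openin (top_of_set (geo_simplex \<sigma>)) (U \<inter> geo_simplex \<sigma>)))"
    unfolding istopology_def
  proof (intro conjI allI impI ballI; (elim conjE)?)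
    fix S T \<sigma>
    assume "\<forall>\<sigma>\<in>K. openin (top_of_set (geo_simplex \<sigma>)) (S \<inter> geo_simplex \<sigma>)"
      and "\<forall>\<sigma>\<in>K. openin (top_of_set (geo_simplex \<sigma>)) (T \<inter> geo_simplex \<sigma>)" "\<sigma> \<in> K"
    then have "openin (top_of_set (geo_simplex \<sigma>)) ((S \<inter> geo_simplex \<sigma>) \<inter> (T \<inter> geo_simplex \<sigma>))"
      by blast
    then show "openin (top_of_set (geo_simplex \<sigma>)) (S \<inter> T \<inter> geo_simplex \<sigma>)"
      by (simp add: Int_ac)
  next
    fix \<K> \<sigma>
    assume "\<forall>S\<in>\<K>. S \<subseteq> complex_space K \<and>
      (\<forall>\<sigma>\<in>K. openin (top_of_set (geo_simplex \<sigma>)) (S \<inter> geo_simplex \<sigma>))" "\<sigma> \<in> K"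
    then have "openin (top_of_set (geo_simplex \<sigma>)) (\<Union>S\<in>\<K>. S \<inter> geo_simplex \<sigma>)"
      by (intro openin_Union) auto
    then show "openin (top_of_set (geo_simplex \<sigma>)) (\<Union>\<K> \<inter> geo_simplex \<sigma>)"
      by (simp add: Int_commute Int_Union)
  qed auto
  then show ?thesis
    unfolding realization_def complex_space_def by (simp add: topology_inverse')
qed

lemma topspace_realization [simp]: "topspace (realization K) = complex_space K"
proof -
  have "openin (realization K) (complex_space K)"
    unfolding openin_realization
    by (auto simp: complex_space_def Int_absorb1 SUP_upper)
  then show ?thesis
    by (metis openin_realization openin_subset openin_topspace subset_antisym)
qed

text \<open>Cut out by closed conditions on continuous functions of the coordinates. Hence
  relatively closed parts of a simplex are closed, and finitely many simplices can be
  pasted.\<close>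

lemma closed_geo_simplex: "closed (geo_simplex \<sigma>)"
proof -
  have eq: "geo_simplex \<sigma> = (\<Inter>v. {g. 0 \<le> g v}) \<inter> (\<Inter>v\<in>-\<sigma>. {g. g v = 0}) \<inter> {g. sum g \<sigma> = 1}"
    by (auto simp: geo_simplex_def)
  show ?thesis
    unfolding eq
    by (intro closed_Int closed_INT closed_Collect_le closed_Collect_eq ballI continuous_intros
        continuous_on_product_coordinates)
qed

text \<open>Weak-topology continuity reduces to coordinatewise continuity as soon as the image
  of every simplex lies in a finite subcomplex.\<close>

definition finitary :: "'c::topological_space set \<Rightarrow> 'b set set \<Rightarrow> ('c \<Rightarrow> 'b \<Rightarrow> real) \<Rightarrow> bool" where
  "finitary S L F \<longleftrightarrow> (\<exists>B. finite B \<and> F ` S \<subseteq> complex_space {\<tau>\<in>L. \<tau> \<subseteq> B}) \<and>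
     (\<forall>w. continuous_on S (\<lambda>z. F z w))"

text \<open>A finite \<open>B\<close> spans only finitely many faces, so the parts of their
  simplices outside \<open>U\<close> have a closed union, and \<open>F\<close> is continuous into
  the product topology. This turns coordinatewise continuity into continuity for the weak
  topology.\<close>

lemma closedin_finitary_preimage:
  assumes "finitary S L F" "openin (realization L) U"
  shows "closedin (top_of_set S) {z\<in>S. F z \<notin> U}"
proof -
  obtain B where B: "finite B" "F ` S \<subseteq> complex_space {\<tau>\<in>L. \<tau> \<subseteq> B}"
    using assms by (auto simp: finitary_def)
  define D where "D = (\<Union>\<tau>\<in>{\<tau>\<in>L. \<tau> \<subseteq> B}. geo_simplex \<tau> - U)"
  have "closed (geo_simplex \<tau> - U)" if "\<tau> \<in> L" for \<tau>
  proof -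
    have "openin (top_of_set (geo_simplex \<tau>)) (U \<inter> geo_simplex \<tau>)"
      using assms that by (simp add: openin_realization)
    then have "closedin (top_of_set (geo_simplex \<tau>)) (geo_simplex \<tau> - U \<inter> geo_simplex \<tau>)"
      by (metis closedin_diff closedin_topspace topspace_euclidean_subtopology)
    then show ?thesis
      using closedin_closed_trans[OF _ closed_geo_simplex] by (simp add: Diff_Int_distrib2 Diff_Int)
  qed
  then have "closed D"
    unfolding D_def using B by (intro closed_UN) auto
  moreover have "continuous_on S F"
    using assms by (auto simp: finitary_def intro: continuous_on_coordinatewise_then_product)
  ultimately have "closedin (top_of_set S) (S \<inter> F -` D)"
    by (rule continuous_closedin_preimage[rotated])
  moreover have "S \<inter> F -` D = {z\<in>S. F z \<notin> U}"
    using B by (fastforce simp: D_def complex_space_def)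
  ultimately show ?thesis
    by simp
qed

lemma complex_space_mono: "K \<subseteq> L \<Longrightarrow> complex_space K \<subseteq> complex_space L"
  by (auto simp: complex_space_def)

lemma finitary_imp_complex_space: "finitary S L F \<Longrightarrow> z \<in> S \<Longrightarrow> F z \<in> complex_space L"
  unfolding finitary_def using complex_space_mono[of "{\<tau>\<in>L. \<tau> \<subseteq> _}" L] by fast

text \<open>The product of the weak topology with the interval needs the tube lemma on each
  simplex: the points whose fibre over a compact interval stays in an open set form a weakly
  open set.\<close>

lemma continuous_map_prod_realization:
  assumes F: "\<And>\<sigma>. \<sigma> \<in> K \<Longrightarrow> finitary ({0..1::real} \<times> geo_simplex \<sigma>) L F"
  shows "continuous_map (prod_topology (top_of_set {0..1}) (realization K)) (realization L) F"
  unfolding continuous_map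
proof (intro conjI allI impI)
  show "F ` topspace (prod_topology (top_of_set {0..1}) (realization K)) \<subseteq> topspace (realization L)"
    using finitary_imp_complex_space[OF F] by (force simp: complex_space_def[of K])
next
  fix U
  assume U: "openin (realization L) U"
  have "\<exists>A W. openin (top_of_set {0..1}) A \<and> openin (realization K) W \<and> t0 \<in> A \<and> x0 \<in> W \<and>
          A \<times> W \<subseteq> {z \<in> {0..1} \<times> complex_space K. F z \<in> U}"
    if t0: "t0 \<in> {0..1}" and x0: "x0 \<in> complex_space K" and "F (t0, x0) \<in> U" for t0 x0
  proof -
    obtain \<sigma>0 where \<sigma>0: "\<sigma>0 \<in> K" "x0 \<in> geo_simplex \<sigma>0"
      using x0 by (auto simp: complex_space_def)
    have "closedin (top_of_set {0..1}) ({0..1} \<inter> (\<lambda>t. (t, x0)) -`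
            {z \<in> {0..1} \<times> geo_simplex \<sigma>0. F z \<notin> U})"
      using \<sigma>0
      by (intro continuous_closedin_preimage_gen[OF _ _ closedin_finitary_preimage[OF F U]]
          continuous_intros) auto
    then have "openin (top_of_set {0..1}) ({0..1} - {0..1} \<inter> (\<lambda>t. (t, x0)) -`
            {z \<in> {0..1} \<times> geo_simplex \<sigma>0. F z \<notin> U})"
      by (simp add: closedin_def)
    also have "{0..1} - {0..1} \<inter> (\<lambda>t. (t, x0)) -` {z \<in> {0..1} \<times> geo_simplex \<sigma>0. F z \<notin> U}
        = {t\<in>{0..1}. F (t, x0) \<in> U}"
      using \<sigma>0 by auto
    finally have "\<exists>e>0. cball t0 e \<inter> {0..1} \<subseteq> {t\<in>{0..1}. F (t, x0) \<in> U}"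
      using that unfolding openin_contains_cball by blast
    then obtain e where e: "e > 0" "\<And>t. t \<in> {0..1} \<Longrightarrow> t \<in> cball t0 e \<Longrightarrow> F (t, x0) \<in> U"
      by blast
    define J where "J = {0..1} \<inter> cball t0 e"
    have J: "compact J" "J \<subseteq> {0..1}"
      by (auto simp: J_def intro: compact_Int)
    define W where "W = {x \<in> complex_space K. \<forall>t\<in>J. F (t, x) \<in> U}"
    have "openin (top_of_set (geo_simplex \<sigma>)) (W \<inter> geo_simplex \<sigma>)" if \<sigma>: "\<sigma> \<in> K" for \<sigma>
    proof -
      \<comment> \<open>\<open>?C\<close> collects the bad points over \<open>J\<close>. Projection
        along the compact factor \<open>J\<close> is a closed map, so the points of the simplex with
        no bad point in their fibre form a relatively open set, the trace of
        \<open>W\<close>.\<close>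
      let ?C = "{z \<in> {0..1} \<times> geo_simplex \<sigma>. F z \<notin> U} \<inter> (J \<times> geo_simplex \<sigma>)"
      have "closedin (top_of_set (J \<times> geo_simplex \<sigma>)) ?C"
        using closedin_finitary_preimage[OF F[OF \<sigma>] U] J
        unfolding closedin_closed by blast
      then have "closedin (prod_topology (top_of_set J) (top_of_set (geo_simplex \<sigma>))) ?C"
        by simp
      moreover have "closed_map (prod_topology (top_of_set J) (top_of_set (geo_simplex \<sigma>)))
          (top_of_set (geo_simplex \<sigma>)) snd"
        using J Abstract_Topological_Spaces.closed_map_snd compact_space_subtopology
        by (metis compactin_euclidean_iff)
      ultimately have "closedin (top_of_set (geo_simplex \<sigma>)) (snd ` ?C)"
        by (simp add: closed_map_def)
      then have "openin (top_of_set (geo_simplex \<sigma>)) (geo_simplex \<sigma> - snd ` ?C)"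
        by (simp add: closedin_def)
      also have "geo_simplex \<sigma> - snd ` ?C = W \<inter> geo_simplex \<sigma>"
      proof -
        have "geo_simplex \<sigma> \<subseteq> complex_space K"
          using \<sigma> by (auto simp: complex_space_def)
        then show ?thesis
          using J(2) by (auto simp: W_def image_iff Bex_def Ball_def simp del: atLeastAtMost_iff) blast
      qed
      finally show ?thesis .
    qed
    then have "openin (realization K) W"
      unfolding openin_realization by (auto simp: W_def)
    moreover have "openin (top_of_set {0..1}) ({0..1} \<inter> ball t0 e)"
      by (simp add: openin_open_Int)
    moreover have "t0 \<in> {0..1} \<inter> ball t0 e" "x0 \<in> W"
      using t0 x0 e by (auto simp: W_def J_def)
    moreover have "({0..1} \<inter> ball t0 e) \<times> W \<subseteq> {z \<in> {0..1} \<times> complex_space K. F z \<in> U}"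
      by (auto simp: W_def J_def)
    ultimately show ?thesis
      by blast
  qed
  then show "openin (prod_topology (top_of_set {0..1}) (realization K))
      {z \<in> topspace (prod_topology (top_of_set {0..1}) (realization K)). F z \<in> U}"
    unfolding openin_prod_topology_alt by auto
qed

section \<open>Homotopies given simplex by simplex\<close>

lemma homotopic_realization:
  assumes F: "\<And>\<sigma>. \<sigma> \<in> K \<Longrightarrow> finitary ({0..1::real} \<times> geo_simplex \<sigma>) L F"
    and "\<And>x. x \<in> complex_space K \<Longrightarrow> F (0, x) = f x" "\<And>x. x \<in> complex_space K \<Longrightarrow> F (1, x) = g x"
  shows "homotopic_with (\<lambda>x. True) (realization K) (realization L) f g"
  using continuous_map_prod_realization[OF F] assms(2,3)
  by (subst homotopic_with) auto

lemma finitary_compose: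
  assumes "finitary S L F" "continuous_on T h" "h ` T \<subseteq> S"
  shows "finitary T L (\<lambda>z. F (h z))"
proof -
  have "continuous_on T (\<lambda>z. F (h z) w)" for w
    using assms continuous_on_compose2[of S "\<lambda>z. F z w" T h] by (auto simp: finitary_def)
  then show ?thesis
    using assms unfolding finitary_def by fast
qed

lemma continuous_map_realization:
  assumes "\<And>\<sigma>. \<sigma> \<in> K \<Longrightarrow> finitary (geo_simplex \<sigma>) L f"
  shows "continuous_map (realization K) (realization L) f"
proof -
  \<comment> \<open>A constant homotopy: continuity of \<open>f\<close> is read off from its
    end.\<close>
  have "homotopic_with (\<lambda>x. True) (realization K) (realization L) f f"
    using assms by (intro homotopic_realization[where F="\<lambda>z. f (snd z)"]
        finitary_compose[where h=snd] continuous_intros) auto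
  then show ?thesis
    using homotopic_with_imp_continuous_maps by blast
qed

text \<open>The image of \<open>f\<close> lies in the finitely many simplices spanned inside
  \<open>B\<close>. On their union \<open>g\<close> is continuous by pasting along closed sets, and
  the union of the bounds \<open>C\<close> is again finite.\<close>

lemma finitary_comp_finitary:
  assumes f: "finitary S K f" and g: "\<And>\<sigma>. \<sigma> \<in> K \<Longrightarrow> finitary (geo_simplex \<sigma>) L g"
  shows "finitary S L (g \<circ> f)"
proof -
  obtain B where B: "finite B" "f ` S \<subseteq> complex_space {\<sigma>\<in>K. \<sigma> \<subseteq> B}"
    using f by (auto simp: finitary_def)
  define I where "I = {\<sigma>\<in>K. \<sigma> \<subseteq> B}"
  have fin: "finite I"
    using B by (auto simp: I_def)
  have "\<forall>\<sigma>\<in>I. \<exists>C. finite C \<and> g ` geo_simplex \<sigma> \<subseteq> complex_space {\<tau>\<in>L. \<tau> \<subseteq> C}"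
    using g by (auto simp: I_def finitary_def)
  then obtain C where C: "\<And>\<sigma>. \<sigma> \<in> I \<Longrightarrow> finite (C \<sigma>)"
    "\<And>\<sigma>. \<sigma> \<in> I \<Longrightarrow> g ` geo_simplex \<sigma> \<subseteq> complex_space {\<tau>\<in>L. \<tau> \<subseteq> C \<sigma>}"
    by metis
  have "continuous_on (\<Union>\<sigma>\<in>I. geo_simplex \<sigma>) (\<lambda>z. g z w)" for w
    using fin g by (intro continuous_on_closed_Union closed_geo_simplex)
      (auto simp: I_def finitary_def)
  moreover have fS: "f ` S \<subseteq> (\<Union>\<sigma>\<in>I. geo_simplex \<sigma>)"
    using B by (simp add: I_def complex_space_def)
  moreover have "continuous_on S f"
    using f by (auto simp: finitary_def intro: continuous_on_coordinatewise_then_product)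
  ultimately have "continuous_on S (\<lambda>z. g (f z) w)" for w
    using continuous_on_compose2[of "\<Union>\<sigma>\<in>I. geo_simplex \<sigma>" "\<lambda>z. g z w" S f] by blast
  moreover have "(g \<circ> f) ` S \<subseteq> complex_space {\<tau>\<in>L. \<tau> \<subseteq> (\<Union>\<sigma>\<in>I. C \<sigma>)}"
  proof
    fix y assume "y \<in> (g \<circ> f) ` S"
    then obtain \<sigma> x where "\<sigma> \<in> I" "x \<in> geo_simplex \<sigma>" "y = g x"
      using fS by fastforce
    then have "y \<in> complex_space {\<tau>\<in>L. \<tau> \<subseteq> C \<sigma>}"
      using C by blast
    moreover have "{\<tau>\<in>L. \<tau> \<subseteq> C \<sigma>} \<subseteq> {\<tau>\<in>L. \<tau> \<subseteq> (\<Union>\<sigma>\<in>I. C \<sigma>)}"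
      using \<open>\<sigma> \<in> I\<close> by blast
    ultimately show "y \<in> complex_space {\<tau>\<in>L. \<tau> \<subseteq> (\<Union>\<sigma>\<in>I. C \<sigma>)}"
      using complex_space_mono by blast
  qed
  ultimately show ?thesis
    using fin C unfolding finitary_def by (auto intro!: exI[of _ "\<Union>\<sigma>\<in>I. C \<sigma>"])
qed

lemma finitary_id: "finite \<sigma> \<Longrightarrow> \<sigma> \<in> K \<Longrightarrow> finitary (geo_simplex \<sigma>) K id"
  unfolding finitary_def complex_space_def
  by (auto intro!: exI[of _ \<sigma>] continuous_on_subset[OF continuous_on_product_coordinates])

text \<open>Contiguous maps: a convex combination of \<open>f x\<close> and \<open>g x\<close> is
  supported in the union of their supports, which is a face by assumption, so the segment stays in
  the realization.\<close>

lemma homotopic_straight_line: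
  assumes K: "complex_on K" and L: "complex_on L"
    and f: "\<And>\<sigma>. \<sigma> \<in> K \<Longrightarrow> finitary (geo_simplex \<sigma>) L f"
    and g: "\<And>\<sigma>. \<sigma> \<in> K \<Longrightarrow> finitary (geo_simplex \<sigma>) L g"
    and fg: "\<And>x. x \<in> complex_space K \<Longrightarrow> spt (f x) \<union> spt (g x) \<in> L"
  shows "homotopic_with (\<lambda>x. True) (realization K) (realization L) f g"
proof (rule homotopic_realization[where F="\<lambda>z v. (1 - fst z) * f (snd z) v + fst z * g (snd z) v"])
  fix \<sigma> assume \<sigma>: "\<sigma> \<in> K"
  obtain B where B: "finite B" "f ` geo_simplex \<sigma> \<subseteq> complex_space {\<tau>\<in>L. \<tau> \<subseteq> B}"
    using f[OF \<sigma>] by (auto simp: finitary_def)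
  obtain C where C: "finite C" "g ` geo_simplex \<sigma> \<subseteq> complex_space {\<tau>\<in>L. \<tau> \<subseteq> C}"
    using g[OF \<sigma>] by (auto simp: finitary_def)
  have mem: "(\<lambda>v. (1 - t) * f x v + t * g x v) \<in> complex_space {\<tau>\<in>L. \<tau> \<subseteq> B \<union> C}"
    if t: "t \<in> {0..1}" and x: "x \<in> geo_simplex \<sigma>" for t x
  proof -
    let ?\<rho> = "spt (f x) \<union> spt (g x)"
    have \<rho>: "?\<rho> \<in> L"
      using fg x \<sigma> by (auto simp: complex_space_def)
    note fin = complex_onD(1)[OF L \<rho>]
    have fx: "\<forall>v. 0 \<le> f x v" "sum (f x) (spt (f x)) = 1"
      and gx: "\<forall>v. 0 \<le> g x v" "sum (g x) (spt (g x)) = 1"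
      using finitary_imp_complex_space[OF f[OF \<sigma>] x] finitary_imp_complex_space[OF g[OF \<sigma>] x]
      by (auto simp: complex_space_iff[OF L])
    have "sum (f x) ?\<rho> = 1" "sum (g x) ?\<rho> = 1"
      using fx gx sum_eq_sum_spt[OF fin] by auto
    then have "(\<lambda>v. (1 - t) * f x v + t * g x v) \<in> geo_simplex ?\<rho>"
      using fx gx t
      by (auto simp: geo_simplex_def sum.distrib sum_distrib_left[symmetric] spt_def)
    moreover have "spt (f x) \<subseteq> B"
      using B(2) x spt_geo_simplex(1) by (fastforce simp: complex_space_def)
    moreover have "spt (g x) \<subseteq> C"
      using C(2) x spt_geo_simplex(1) by (fastforce simp: complex_space_def)
    ultimately show ?thesis
      using \<rho> by (auto simp: complex_space_def)
  qed
  have cont: "continuous_on ({0..1} \<times> geo_simplex \<sigma>)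
      (\<lambda>z. (1 - fst z) * f (snd z) w + fst z * g (snd z) w)" for w
  proof -
    have "continuous_on (geo_simplex \<sigma>) (\<lambda>x. f x w)" "continuous_on (geo_simplex \<sigma>) (\<lambda>x. g x w)"
      using f[OF \<sigma>] g[OF \<sigma>] by (auto simp: finitary_def)
    then show ?thesis
      by (intro continuous_intros continuous_on_compose2[of "geo_simplex \<sigma>" _ _ snd]) auto
  qed
  have "(\<lambda>z v. (1 - fst z) * f (snd z) v + fst z * g (snd z) v) ` ({0..1} \<times> geo_simplex \<sigma>)
      \<subseteq> complex_space {\<tau>\<in>L. \<tau> \<subseteq> B \<union> C}"
    by (rule image_subsetI) (rule mem; simp add: mem_Times_iff)
  moreover have "finite (B \<union> C)"
    using B C by simp
  ultimately show "finitary ({0..1} \<times> geo_simplex \<sigma>) L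
      (\<lambda>z v. (1 - fst z) * f (snd z) v + fst z * g (snd z) v)"
    unfolding finitary_def by (intro conjI exI allI cont)
qed simp_all

section \<open>Rescaling weights to barycentric coordinates\<close>

definition normalize_sum :: "('a \<Rightarrow> real) \<Rightarrow> 'a \<Rightarrow> real" where
  "normalize_sum h = (\<lambda>v. h v / sum h (spt h))"

lemma sum_spt_pos:
  assumes "\<And>v. 0 \<le> h v" "finite (spt h)" "spt h \<noteq> {}"
  shows "0 < sum h (spt h)"
  using assms by (intro sum_pos) (auto simp: spt_def less_le)

lemma spt_normalize_sum:
  assumes "\<And>v. 0 \<le> h v" "finite (spt h)" "spt h \<noteq> {}"
  shows "spt (normalize_sum h) = spt h"
  using sum_spt_pos[OF assms] by (auto simp: spt_def normalize_sum_def)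

lemma normalize_sum_geo_simplex:
  assumes "\<And>v. 0 \<le> h v" "finite (spt h)" "spt h \<noteq> {}"
  shows "normalize_sum h \<in> geo_simplex (spt h)"
  using sum_spt_pos[OF assms] assms(1)
  by (auto simp: geo_simplex_def normalize_sum_def sum_divide_distrib[symmetric]) (auto simp: spt_def)

text \<open>The denominator is a sum over a support that changes with the point. Summing over the
  fixed set \<open>B\<close> gives the same value and makes continuity visible.\<close>

lemma finitary_normalize_sum:
  assumes L: "complex_on L" and B: "finite B"
    and Q: "\<And>z v. z \<in> S \<Longrightarrow> 0 \<le> Q z v" "\<And>z. z \<in> S \<Longrightarrow> spt (Q z) \<subseteq> B" "\<And>z. z \<in> S \<Longrightarrow> spt (Q z) \<in> L"
    and cont: "\<And>v. continuous_on S (\<lambda>z. Q z v)"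
  shows "finitary S L (\<lambda>z. normalize_sum (Q z))"
proof -
  have ne: "spt (Q z) \<noteq> {}" "finite (spt (Q z))" if "z \<in> S" for z
    using complex_onD(1,2)[OF L Q(3)[OF that]] by simp_all
  have "normalize_sum (Q z) \<in> geo_simplex (spt (Q z))" if "z \<in> S" for z
    by (intro normalize_sum_geo_simplex Q(1) ne that)
  then have "(\<lambda>z. normalize_sum (Q z)) ` S \<subseteq> complex_space {\<tau>\<in>L. \<tau> \<subseteq> B}"
    using Q(2,3) unfolding complex_space_def by blast
  moreover have quot: "continuous_on S (\<lambda>z. Q z w / sum (Q z) B)" for w
  proof (intro continuous_intros cont ballI)
    fix z assume "z \<in> S"
    then have "0 < sum (Q z) (spt (Q z))"
      by (intro sum_spt_pos Q(1) ne)
    then show "sum (Q z) B \<noteq> 0"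
      using sum_eq_sum_spt[OF B Q(2)[OF \<open>z \<in> S\<close>]] by simp
  qed
  have "continuous_on S (\<lambda>z. normalize_sum (Q z) w)" for w
    by (rule continuous_on_eq[OF quot[of w]]) (simp add: normalize_sum_def sum_eq_sum_spt[OF B Q(2)])
  ultimately show ?thesis
    using B by (auto simp: finitary_def)
qed

section \<open>Maps on the barycentric subdivision\<close>

lemma continuous_on_if_zero:
  fixes h :: "'c::topological_space \<Rightarrow> real"
  shows "continuous_on S h \<Longrightarrow> continuous_on S (\<lambda>z. if P then h z else 0)"
  by (cases P) auto

lemma continuous_on_Min_image:
  fixes f :: "'v \<Rightarrow> 'c::topological_space \<Rightarrow> real"
  assumes "finite \<tau>" "\<tau> \<noteq> {}" "\<And>v. v \<in> \<tau> \<Longrightarrow> continuous_on S (f v)"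
  shows "continuous_on S (\<lambda>z. Min ((\<lambda>v. f v z) ` \<tau>))"
  using assms by (induction rule: finite_ne_induct) (auto intro!: continuous_on_min)

lemma continuous_on_Max_image:
  fixes f :: "'v \<Rightarrow> 'c::topological_space \<Rightarrow> real"
  assumes "finite \<tau>" "\<And>v. v \<in> \<tau> \<Longrightarrow> continuous_on S (f v)"
  shows "continuous_on S (\<lambda>z. Max (insert 0 ((\<lambda>v. f v z) ` \<tau>)))"
  using assms
proof (induction rule: finite_induct)
  case (insert v \<tau>)
  have "Max (insert 0 ((\<lambda>v. f v z) ` insert v \<tau>)) = max (f v z) (Max (insert 0 ((\<lambda>v. f v z) ` \<tau>)))" for z
    using insert.hyps by (simp add: insert_commute[of 0])
  then show ?case
    using insert by (auto intro!: continuous_on_max)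
qed auto

section \<open>Superlevel sets and their intervals of levels\<close>

definition superlevels :: "('a \<Rightarrow> real) \<Rightarrow> 'a set set" where
  "superlevels x = {\<tau>. \<tau> \<noteq> {} \<and> (\<exists>\<alpha>>0. \<tau> = {v. \<alpha> \<le> x v})}"

definition lower :: "'a set \<Rightarrow> ('a \<Rightarrow> real) \<Rightarrow> real" where
  "lower \<tau> x = Min (x ` \<tau>)"

text \<open>For positive \<alpha>, a nonempty \<tau> inside a finite support is the superlevel set
  at \<alpha> exactly when \<open>upper \<tau> x < \<alpha>\<close> and
  \<open>\<alpha> \<le> lower \<tau> x\<close>. The inserted 0 stops the levels at 0 and covers the
  case \<open>\<tau> = spt x\<close>.\<close>

definition upper :: "'a set \<Rightarrow> ('a \<Rightarrow> real) \<Rightarrow> real" where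
  "upper \<tau> x = Max (insert 0 (x ` (spt x - \<tau>)))"

lemma superlevels_subset_spt: "\<tau> \<in> superlevels x \<Longrightarrow> \<tau> \<subseteq> spt x"
  by (auto simp: superlevels_def spt_def)

text \<open>Raising the threshold shrinks the set. The resulting chain is the flag of faces that
  carries \<open>x\<close> in the barycentric subdivision.\<close>

lemma superlevels_nested:
  assumes "\<tau> \<in> superlevels x" "\<tau>' \<in> superlevels x"
  shows "\<tau> \<subseteq> \<tau>' \<or> \<tau>' \<subseteq> \<tau>"
proof -
  obtain \<alpha> \<beta> where "\<tau> = {v. \<alpha> \<le> x v}" "\<tau>' = {v. \<beta> \<le> x v}"
    using assms by (auto simp: superlevels_def)
  then show ?thesis
    by (cases "\<alpha> \<le> \<beta>") auto
qed

lemma superlevels_nonempty: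
  assumes "\<And>v. 0 \<le> x v" "finite (spt x)" "spt x \<noteq> {}"
  shows "superlevels x \<noteq> {}"
proof -
  let ?\<alpha> = "Max (x ` spt x)"
  have "?\<alpha> \<in> x ` spt x"
    using assms by (intro Max_in) auto
  then obtain v where "v \<in> spt x" "x v = ?\<alpha>"
    by auto
  moreover from this have "0 < ?\<alpha>"
    using assms(1)[of v] by (simp add: spt_def less_le)
  ultimately have "{v. ?\<alpha> \<le> x v} \<in> superlevels x"
    unfolding superlevels_def by (auto intro!: exI[of _ ?\<alpha>] exI[of _ v])
  then show ?thesis
    by blast
qed

lemma upper_nonneg: "finite (spt x) \<Longrightarrow> 0 \<le> upper \<tau> x"
  by (simp add: upper_def)

lemma upper_ge:
  assumes "\<And>v. 0 \<le> x v" "finite (spt x)" "v \<notin> \<tau>"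
  shows "x v \<le> upper \<tau> x"
proof (cases "v \<in> spt x")
  case True
  then show ?thesis
    using assms by (auto simp: upper_def intro!: Max_ge)
next
  case False
  then show ?thesis
    using assms upper_nonneg by (simp add: spt_def)
qed

text \<open>The levels at which \<tau> occurs run from \<open>upper \<tau> x\<close>, excluded, to
  \<open>lower \<tau> x\<close>, included. If this range is nonempty it contains
  \<open>lower \<tau> x\<close>, the threshold used for the converse.\<close>

lemma superlevels_iff:
  assumes x: "\<And>v. 0 \<le> x v" "finite (spt x)" and \<tau>: "\<tau> \<subseteq> spt x" "\<tau> \<noteq> {}"
  shows "\<tau> \<in> superlevels x \<longleftrightarrow> upper \<tau> x < lower \<tau> x"
proof
  have fin: "finite \<tau>"
    using x \<tau> finite_subset by blast
  assume "\<tau> \<in> superlevels x"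
  then obtain \<alpha> where \<alpha>: "\<alpha> > 0" "\<tau> = {v. \<alpha> \<le> x v}"
    by (auto simp: superlevels_def)
  have "upper \<tau> x < \<alpha>"
    using x \<alpha> by (auto simp: upper_def)
  moreover have "\<alpha> \<le> lower \<tau> x"
    using \<alpha> fin \<tau>(2) unfolding lower_def by (subst Min_ge_iff) auto
  ultimately show "upper \<tau> x < lower \<tau> x"
    by simp
next
  have fin: "finite \<tau>"
    using x \<tau> finite_subset by blast
  assume less: "upper \<tau> x < lower \<tau> x"
  have "v \<in> \<tau> \<longleftrightarrow> lower \<tau> x \<le> x v" for v
    using less upper_ge[where x=x, OF x, of v \<tau>] fin by (force simp: lower_def)
  moreover have "0 < lower \<tau> x"
    using less upper_nonneg[OF x(2), of \<tau>] by simp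
  ultimately show "\<tau> \<in> superlevels x"
    using \<tau> by (auto simp: superlevels_def)
qed

text \<open>A face is weighted by the length of the interval of levels at which it is the superlevel
  set. Levels below t send it to \<open>\<Phi>1\<close>, levels above t to \<open>\<Phi>0\<close>. As larger faces occur at lower
  levels, letting t run from 0 to 1 is the prism homotopy from \<open>\<Phi>0\<close> to \<open>\<Phi>1\<close> on the barycentric
  subdivision.\<close>

definition level_map :: "('a set \<Rightarrow> 'b) \<Rightarrow> ('a set \<Rightarrow> 'b) \<Rightarrow> real \<Rightarrow> ('a \<Rightarrow> real) \<Rightarrow> 'b \<Rightarrow> real" where
  "level_map \<Phi>0 \<Phi>1 t x w = (\<Sum>\<tau>\<in>Pow (spt x) - {{}}.
     (if \<Phi>0 \<tau> = w then max 0 (lower \<tau> x - max (upper \<tau> x) t) else 0) +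
     (if \<Phi>1 \<tau> = w then max 0 (min (lower \<tau> x) t - upper \<tau> x) else 0))"

text \<open>At \<open>t = 0\<close> each \<tau> is weighted by the length of its level interval.
  Barycentric coordinates in the subdivision would carry an extra factor \<open>card \<tau>\<close>;
  here normalization restores the total 1, and the supporting flag is the same.\<close>

definition subdivision_map :: "('a set \<Rightarrow> 'b) \<Rightarrow> ('a \<Rightarrow> real) \<Rightarrow> 'b \<Rightarrow> real" where
  "subdivision_map \<Phi> x = normalize_sum (level_map \<Phi> \<Phi> 0 x)"

lemma level_map_nonneg: "0 \<le> level_map \<Phi>0 \<Phi>1 t x w"
  by (auto simp: level_map_def intro!: sum_nonneg)

text \<open>All summands are nonnegative, so nothing cancels: a value occurs exactly when the level
  interval of some \<tau> sent to it reaches above t for \<open>\<Phi>0\<close> or below t for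
  \<open>\<Phi>1\<close>.\<close>

lemma spt_level_map:
  assumes x: "\<And>v. 0 \<le> x v" "finite (spt x)"
  shows "spt (level_map \<Phi>0 \<Phi>1 t x) =
     \<Phi>0 ` {\<tau>\<in>superlevels x. t < lower \<tau> x} \<union> \<Phi>1 ` {\<tau>\<in>superlevels x. upper \<tau> x < t}"
proof -
  have "level_map \<Phi>0 \<Phi>1 t x w \<noteq> 0 \<longleftrightarrow> (\<exists>\<tau>\<in>Pow (spt x) - {{}}.
      \<Phi>0 \<tau> = w \<and> max (upper \<tau> x) t < lower \<tau> x \<or> \<Phi>1 \<tau> = w \<and> upper \<tau> x < min (lower \<tau> x) t)" for w
  proof -
    have "(if \<Phi>0 \<tau> = w then max 0 (lower \<tau> x - max (upper \<tau> x) t) else 0) +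
        (if \<Phi>1 \<tau> = w then max 0 (min (lower \<tau> x) t - upper \<tau> x) else 0) = 0 \<longleftrightarrow>
      \<not> (\<Phi>0 \<tau> = w \<and> max (upper \<tau> x) t < lower \<tau> x \<or> \<Phi>1 \<tau> = w \<and> upper \<tau> x < min (lower \<tau> x) t)" for \<tau>
      by (auto simp: max_def min_def)
    then show ?thesis
      unfolding level_map_def using x(2) by (subst sum_nonneg_eq_0_iff) auto
  qed
  moreover have "\<tau> \<in> superlevels x \<longleftrightarrow> \<tau> \<in> Pow (spt x) - {{}} \<and> upper \<tau> x < lower \<tau> x" for \<tau>
    using superlevels_iff[where x=x, OF x, of \<tau>] superlevels_subset_spt[of \<tau> x]
    by (auto simp: superlevels_def)
  ultimately show ?thesis
    by (auto simp: spt_def[of "level_map _ _ _ _"])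
qed

lemma spt_level_map_0:
  assumes x: "\<And>v. 0 \<le> x v" "finite (spt x)"
  shows "spt (level_map \<Phi>0 \<Phi>1 0 x) = \<Phi>0 ` superlevels x"
proof -
  have "0 < lower \<tau> x" if "\<tau> \<in> superlevels x" for \<tau>
    using that superlevels_iff[where x=x, OF x superlevels_subset_spt[OF that]] upper_nonneg[OF x(2), of \<tau>]
    by (auto simp: superlevels_def)
  then show ?thesis
    using upper_nonneg[OF x(2), THEN leD] by (auto simp: spt_level_map[where x=x, OF x])
qed

lemma spt_subdivision_map:
  assumes x: "\<And>v. 0 \<le> x v" "finite (spt x)" "spt x \<noteq> {}"
  shows "spt (subdivision_map \<Phi> x) = \<Phi> ` superlevels x"
proof -
  have "superlevels x \<subseteq> Pow (spt x)"
    using superlevels_subset_spt by blast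
  then have "finite (superlevels x)"
    using x by (meson finite_Pow_iff finite_subset)
  then show ?thesis
    unfolding subdivision_map_def
    using superlevels_nonempty[where x=x, OF x] spt_level_map_0[where x=x, OF x(1,2), of \<Phi> \<Phi>]
    by (subst spt_normalize_sum) (auto simp: level_map_nonneg)
qed

lemma level_map_0: "finite (spt x) \<Longrightarrow> level_map \<Phi>0 \<Phi>1 0 x = level_map \<Phi>0 \<Phi>0 0 x"
  unfolding level_map_def fun_eq_iff
proof (intro allI sum.cong refl)
  fix w \<tau>
  assume "finite (spt x)"
  then have "0 \<le> upper \<tau> x"
    by (rule upper_nonneg)
  then show "(if \<Phi>0 \<tau> = w then max 0 (lower \<tau> x - max (upper \<tau> x) 0) else 0) +
      (if \<Phi>1 \<tau> = w then max 0 (min (lower \<tau> x) 0 - upper \<tau> x) else 0) =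
      (if \<Phi>0 \<tau> = w then max 0 (lower \<tau> x - max (upper \<tau> x) 0) else 0) +
      (if \<Phi>0 \<tau> = w then max 0 (min (lower \<tau> x) 0 - upper \<tau> x) else 0)"
    by (auto simp: max_def min_def)
qed

lemma level_map_1:
  assumes "finite (spt x)" "\<And>v. x v \<le> 1"
  shows "level_map \<Phi>0 \<Phi>1 1 x = level_map \<Phi>1 \<Phi>1 0 x"
  unfolding level_map_def fun_eq_iff
proof (intro allI sum.cong refl)
  fix w \<tau>
  assume "\<tau> \<in> Pow (spt x) - {{}}"
  then have "finite \<tau>" "\<tau> \<noteq> {}"
    using assms finite_subset by auto
  then have "lower \<tau> x \<le> 1"
    using assms by (auto simp: lower_def Min_le_iff)
  then show "(if \<Phi>0 \<tau> = w then max 0 (lower \<tau> x - max (upper \<tau> x) 1) else 0) +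
      (if \<Phi>1 \<tau> = w then max 0 (min (lower \<tau> x) 1 - upper \<tau> x) else 0) =
      (if \<Phi>1 \<tau> = w then max 0 (lower \<tau> x - max (upper \<tau> x) 0) else 0) +
      (if \<Phi>1 \<tau> = w then max 0 (min (lower \<tau> x) 0 - upper \<tau> x) else 0)"
    using upper_nonneg[OF assms(1), of \<tau>] by (auto simp: max_def min_def)
qed

lemma upper_eq:
  assumes "spt x \<subseteq> \<sigma>"
  shows "upper \<tau> x = Max (insert 0 (x ` (\<sigma> - \<tau>)))"
proof -
  have "insert 0 (x ` (spt x - \<tau>)) = insert 0 (x ` (\<sigma> - \<tau>))"
    using assms by (auto simp: spt_def image_iff)
  then show ?thesis
    by (simp add: upper_def)
qed

text \<open>Replaces the index set \<open>Pow (spt x)\<close>, which varies with \<open>x\<close>,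
  by a fixed one, so that continuity can be checked summand by summand. The additional faces contain
  a vertex of coordinate 0 and get weight 0.\<close>

lemma level_map_eq:
  assumes x: "\<And>v. 0 \<le> x v" "finite \<sigma>" "spt x \<subseteq> \<sigma>" and t: "0 \<le> t"
  shows "level_map \<Phi>0 \<Phi>1 t x w = (\<Sum>\<tau>\<in>Pow \<sigma> - {{}}.
     (if \<Phi>0 \<tau> = w then max 0 (lower \<tau> x - max (upper \<tau> x) t) else 0) +
     (if \<Phi>1 \<tau> = w then max 0 (min (lower \<tau> x) t - upper \<tau> x) else 0))"
  unfolding level_map_def
proof (intro sum.mono_neutral_left ballI)
  fix \<tau>
  assume \<tau>: "\<tau> \<in> Pow \<sigma> - {{}} - (Pow (spt x) - {{}})"
  then obtain v where "v \<in> \<tau>" "x v = 0"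
    by (auto simp: spt_def)
  moreover have "finite \<tau>"
    using \<tau> x finite_subset by auto
  ultimately have "lower \<tau> x \<le> 0"
    unfolding lower_def by (metis Min_le finite_imageI imageI)
  moreover have "0 \<le> upper \<tau> x"
    using x by (intro upper_nonneg) (auto intro: finite_subset)
  ultimately show "(if \<Phi>0 \<tau> = w then max 0 (lower \<tau> x - max (upper \<tau> x) t) else 0) +
     (if \<Phi>1 \<tau> = w then max 0 (min (lower \<tau> x) t - upper \<tau> x) else 0) = 0"
    by auto
qed (use x in auto)

section \<open>Prism maps into flag complexes\<close>

definition flag_complex :: "'a set set \<Rightarrow> bool" where
  "flag_complex L \<longleftrightarrow> (\<forall>S. finite S \<longrightarrow> S \<noteq> {} \<longrightarrow> (\<forall>u\<in>S. \<forall>v\<in>S. {u, v} \<in> L) \<longrightarrow> S \<in> L)"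

text \<open>In a flag complex it suffices to check pairs. Values of one family come from nested
  superlevel sets; in a mixed pair the argument of \<open>\<Phi>0\<close> lies inside that of
  \<open>\<Phi>1\<close>, which is the inclusion assumed in \<open>01\<close>.\<close>

lemma spt_level_map_in_flag_complex:
  assumes L: "flag_complex L"
    and K: "complex_on K" "x \<in> geo_simplex \<sigma>" "\<sigma> \<in> K"
    and 00: "\<And>\<tau> \<tau>'. \<tau> \<in> K \<Longrightarrow> \<tau>' \<in> K \<Longrightarrow> \<tau> \<subseteq> \<tau>' \<Longrightarrow> {\<Phi>0 \<tau>, \<Phi>0 \<tau>'} \<in> L"
    and 11: "\<And>\<tau> \<tau>'. \<tau> \<in> K \<Longrightarrow> \<tau>' \<in> K \<Longrightarrow> \<tau> \<subseteq> \<tau>' \<Longrightarrow> {\<Phi>1 \<tau>, \<Phi>1 \<tau>'} \<in> L"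
    and 01: "\<And>\<tau> \<tau>'. \<tau> \<in> K \<Longrightarrow> \<tau>' \<in> K \<Longrightarrow> \<tau> \<subseteq> \<tau>' \<Longrightarrow> {\<Phi>0 \<tau>, \<Phi>1 \<tau>'} \<in> L"
  shows "spt (level_map \<Phi>0 \<Phi>1 t x) \<in> L"
proof -
  have x: "\<And>v. 0 \<le> x v" "finite (spt x)" "spt x \<noteq> {}" "spt x \<in> K"
    using K spt_geo_simplex[OF K(2)] complex_onD[OF K(1,3)]
    by (auto simp: geo_simplex_nonneg intro: finite_subset)
  let ?A = "{\<tau>\<in>superlevels x. t < lower \<tau> x}" and ?C = "{\<tau>\<in>superlevels x. upper \<tau> x < t}"
  have inK: "\<tau> \<in> K" if "\<tau> \<in> superlevels x" for \<tau>
    using that superlevels_subset_spt[OF that] complex_onD(3)[OF K(1) x(4)]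
    by (auto simp: superlevels_def)
  \<comment> \<open>A vertex of \<tau> has coordinate above t, whereas vertices outside
    \<open>\<tau>'\<close> have coordinate below t.\<close>
  have mixed: "\<tau> \<subseteq> \<tau>'" if "\<tau> \<in> ?A" "\<tau>' \<in> ?C" for \<tau> \<tau>'
  proof
    fix v assume "v \<in> \<tau>"
    moreover have "finite \<tau>"
      using that superlevels_subset_spt[of \<tau> x] x(2) by (auto intro: finite_subset)
    ultimately have "lower \<tau> x \<le> x v"
      by (simp add: lower_def)
    then show "v \<in> \<tau>'"
      using that upper_ge[where x=x, OF x(1,2), of v \<tau>'] by force
  qed
  have fin: "finite (superlevels x)"
    using superlevels_subset_spt[of _ x] x(2) by (meson Pow_iff finite_Pow_iff finite_subset subsetI)
  obtain \<tau> where \<tau>: "\<tau> \<in> superlevels x"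
    using superlevels_nonempty[where x=x, OF x(1-3)] by blast
  then have "upper \<tau> x < lower \<tau> x"
    using superlevels_iff[where x=x, OF x(1,2) superlevels_subset_spt[OF \<tau>]]
    by (auto simp: superlevels_def)
  then have "t < lower \<tau> x \<or> upper \<tau> x < t"
    by linarith
  then have ne: "\<Phi>0 ` ?A \<union> \<Phi>1 ` ?C \<noteq> {}"
    using \<tau> by auto
  have aa: "{\<Phi>0 \<tau>, \<Phi>0 \<tau>'} \<in> L" if "\<tau> \<in> superlevels x" "\<tau>' \<in> superlevels x" for \<tau> \<tau>'
    using superlevels_nested[OF that] 00 inK that by (metis insert_commute)
  have cc: "{\<Phi>1 \<tau>, \<Phi>1 \<tau>'} \<in> L" if "\<tau> \<in> superlevels x" "\<tau>' \<in> superlevels x" for \<tau> \<tau>'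
    using superlevels_nested[OF that] 11 inK that by (metis insert_commute)
  have ac: "{\<Phi>0 \<tau>, \<Phi>1 \<tau>'} \<in> L" if "\<tau> \<in> ?A" "\<tau>' \<in> ?C" for \<tau> \<tau>'
    using that by (intro 01 inK mixed) auto
  have pairs: "\<forall>u\<in>\<Phi>0 ` ?A \<union> \<Phi>1 ` ?C. \<forall>v\<in>\<Phi>0 ` ?A \<union> \<Phi>1 ` ?C. {u, v} \<in> L"
    by (safe; (rule aa cc ac | subst insert_commute, rule ac); simp)
  have "finite (\<Phi>0 ` ?A \<union> \<Phi>1 ` ?C)"
    using fin by simp
  then have "\<Phi>0 ` ?A \<union> \<Phi>1 ` ?C \<in> L"
    by (rule L[unfolded flag_complex_def, THEN spec, THEN mp, THEN mp, THEN mp, OF _ ne pairs])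
  then show ?thesis
    by (simp add: spt_level_map[where x=x, OF x(1,2)])
qed

lemma finitary_level_map:
  assumes L: "flag_complex L" "complex_on L"
    and K: "complex_on K" "\<sigma> \<in> K"
    and \<Phi>: "\<And>\<tau> \<tau>'. \<tau> \<in> K \<Longrightarrow> \<tau>' \<in> K \<Longrightarrow> \<tau> \<subseteq> \<tau>' \<Longrightarrow> {\<Phi>0 \<tau>, \<Phi>0 \<tau>'} \<in> L"
     "\<And>\<tau> \<tau>'. \<tau> \<in> K \<Longrightarrow> \<tau>' \<in> K \<Longrightarrow> \<tau> \<subseteq> \<tau>' \<Longrightarrow> {\<Phi>1 \<tau>, \<Phi>1 \<tau>'} \<in> L"
     "\<And>\<tau> \<tau>'. \<tau> \<in> K \<Longrightarrow> \<tau>' \<in> K \<Longrightarrow> \<tau> \<subseteq> \<tau>' \<Longrightarrow> {\<Phi>0 \<tau>, \<Phi>1 \<tau>'} \<in> L"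
  shows "finitary ({0..1} \<times> geo_simplex \<sigma>) L (\<lambda>z. normalize_sum (level_map \<Phi>0 \<Phi>1 (fst z) (snd z)))"
proof (rule finitary_normalize_sum[OF L(2)])
  note fin = complex_onD(1)[OF K]
  show "finite (\<Phi>0 ` Pow \<sigma> \<union> \<Phi>1 ` Pow \<sigma>)"
    using fin by simp
  show "0 \<le> level_map \<Phi>0 \<Phi>1 (fst z) (snd z) v" for z v
    by (rule level_map_nonneg)
  show "spt (level_map \<Phi>0 \<Phi>1 (fst z) (snd z)) \<in> L" if "z \<in> {0..1} \<times> geo_simplex \<sigma>" for z
    using that K \<Phi> by (intro spt_level_map_in_flag_complex[OF L(1) K(1), of _ \<sigma>]) auto
  show "spt (level_map \<Phi>0 \<Phi>1 (fst z) (snd z)) \<subseteq> \<Phi>0 ` Pow \<sigma> \<union> \<Phi>1 ` Pow \<sigma>"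
    if "z \<in> {0..1} \<times> geo_simplex \<sigma>" for z
  proof -
    have x: "snd z \<in> geo_simplex \<sigma>"
      using that by auto
    have "\<And>v. 0 \<le> snd z v" "finite (spt (snd z))" "spt (snd z) \<subseteq> \<sigma>"
      using x spt_geo_simplex[OF x] fin by (auto simp: geo_simplex_nonneg intro: finite_subset)
    then show ?thesis
      using superlevels_subset_spt[of _ "snd z"] by (subst spt_level_map) blast+
  qed
  have coord: "continuous_on ({0..1} \<times> geo_simplex \<sigma>) (\<lambda>z. snd z v)" for v
    by (rule continuous_on_product_then_coordinatewise) (intro continuous_intros)
  \<comment> \<open>Written over the fixed \<sigma>, \<open>lower\<close> and \<open>upper\<close>
    are a minimum and a maximum over index sets that do not depend on the point.\<close>
  have sum: "continuous_on ({0..1} \<times> geo_simplex \<sigma>) (\<lambda>z. (\<Sum>\<tau>\<in>Pow \<sigma> - {{}}.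
     (if \<Phi>0 \<tau> = w then max 0 (Min ((\<lambda>v. snd z v) ` \<tau>) - max (Max (insert 0 ((\<lambda>v. snd z v) ` (\<sigma> - \<tau>)))) (fst z)) else 0) +
     (if \<Phi>1 \<tau> = w then max 0 (min (Min ((\<lambda>v. snd z v) ` \<tau>)) (fst z) - Max (insert 0 ((\<lambda>v. snd z v) ` (\<sigma> - \<tau>)))) else 0)))" for w
  proof (rule continuous_on_sum)
    fix \<tau> assume "\<tau> \<in> Pow \<sigma> - {{}}"
    then have "finite \<tau>" "\<tau> \<noteq> {}"
      using fin finite_subset by auto
    then have *: "continuous_on ({0..1} \<times> geo_simplex \<sigma>) (\<lambda>z. Min ((\<lambda>v. snd z v) ` \<tau>))"
      "continuous_on ({0..1} \<times> geo_simplex \<sigma>) (\<lambda>z. Max (insert 0 ((\<lambda>v. snd z v) ` (\<sigma> - \<tau>))))"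
      using fin coord
      by (auto intro!: continuous_on_Min_image[where f="\<lambda>v z. snd z v"] continuous_on_Max_image[where f="\<lambda>v z. snd z v"])
    show "continuous_on ({0..1} \<times> geo_simplex \<sigma>) (\<lambda>z.
     (if \<Phi>0 \<tau> = w then max 0 (Min ((\<lambda>v. snd z v) ` \<tau>) - max (Max (insert 0 ((\<lambda>v. snd z v) ` (\<sigma> - \<tau>)))) (fst z)) else 0) +
     (if \<Phi>1 \<tau> = w then max 0 (min (Min ((\<lambda>v. snd z v) ` \<tau>)) (fst z) - Max (insert 0 ((\<lambda>v. snd z v) ` (\<sigma> - \<tau>)))) else 0))"
      by (intro continuous_on_add continuous_on_if_zero continuous_on_max continuous_on_min continuous_on_diff
          continuous_on_const continuous_on_fst continuous_on_id *)
  qed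
  show "continuous_on ({0..1} \<times> geo_simplex \<sigma>) (\<lambda>z. level_map \<Phi>0 \<Phi>1 (fst z) (snd z) w)" for w
  proof (rule continuous_on_eq[OF sum[of w]])
    fix z :: "real \<times> _"
    assume z: "z \<in> {0..1} \<times> geo_simplex \<sigma>"
    then have x: "snd z \<in> geo_simplex \<sigma>" and t: "0 \<le> fst z"
      by auto
    show "(\<Sum>\<tau>\<in>Pow \<sigma> - {{}}.
     (if \<Phi>0 \<tau> = w then max 0 (Min ((\<lambda>v. snd z v) ` \<tau>) - max (Max (insert 0 ((\<lambda>v. snd z v) ` (\<sigma> - \<tau>)))) (fst z)) else 0) +
     (if \<Phi>1 \<tau> = w then max 0 (min (Min ((\<lambda>v. snd z v) ` \<tau>)) (fst z) - Max (insert 0 ((\<lambda>v. snd z v) ` (\<sigma> - \<tau>)))) else 0))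
      = level_map \<Phi>0 \<Phi>1 (fst z) (snd z) w"
      unfolding level_map_eq[OF geo_simplex_nonneg[OF x] fin spt_geo_simplex(1)[OF x] t]
        lower_def upper_eq[OF spt_geo_simplex(1)[OF x]] by (rule refl)
  qed
qed

lemma finitary_subdivision_map:
  assumes L: "flag_complex L" "complex_on L" and K: "complex_on K" "\<sigma> \<in> K"
    and \<Phi>: "\<And>\<tau> \<tau>'. \<tau> \<in> K \<Longrightarrow> \<tau>' \<in> K \<Longrightarrow> \<tau> \<subseteq> \<tau>' \<Longrightarrow> {\<Phi> \<tau>, \<Phi> \<tau>'} \<in> L"
  shows "finitary (geo_simplex \<sigma>) L (subdivision_map \<Phi>)"
proof -
  have "finitary (geo_simplex \<sigma>) L
      (\<lambda>x. (\<lambda>z. normalize_sum (level_map \<Phi> \<Phi> (fst z) (snd z))) (0, x))"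
    by (rule finitary_compose[OF finitary_level_map[OF L K]]) (auto intro!: continuous_intros \<Phi>)
  then show ?thesis
    by (simp add: subdivision_map_def[abs_def])
qed

lemma homotopic_subdivision_maps:
  assumes L: "flag_complex L" "complex_on L" and K: "complex_on K"
    and \<Phi>: "\<And>\<tau> \<tau>'. \<tau> \<in> K \<Longrightarrow> \<tau>' \<in> K \<Longrightarrow> \<tau> \<subseteq> \<tau>' \<Longrightarrow> {\<Phi>0 \<tau>, \<Phi>0 \<tau>'} \<in> L"
     "\<And>\<tau> \<tau>'. \<tau> \<in> K \<Longrightarrow> \<tau>' \<in> K \<Longrightarrow> \<tau> \<subseteq> \<tau>' \<Longrightarrow> {\<Phi>1 \<tau>, \<Phi>1 \<tau>'} \<in> L"
     "\<And>\<tau> \<tau>'. \<tau> \<in> K \<Longrightarrow> \<tau>' \<in> K \<Longrightarrow> \<tau> \<subseteq> \<tau>' \<Longrightarrow> {\<Phi>0 \<tau>, \<Phi>1 \<tau>'} \<in> L"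
  shows "homotopic_with (\<lambda>x. True) (realization K) (realization L)
    (subdivision_map \<Phi>0) (subdivision_map \<Phi>1)"
proof (rule homotopic_realization[OF finitary_level_map[OF L K _ \<Phi>]])
  fix x
  assume "x \<in> complex_space K"
  then have x: "\<And>v. 0 \<le> x v" "finite (spt x)" "sum x (spt x) = 1"
    using complex_onD(1)[OF K] by (auto simp: complex_space_iff[OF K])
  have "x v \<le> 1" for v
    using x member_le_sum[of v "spt x" x] by (cases "v \<in> spt x") (auto simp: spt_def)
  then show "normalize_sum (level_map \<Phi>0 \<Phi>1 (fst (1, x)) (snd (1, x))) = subdivision_map \<Phi>1 x"
    using level_map_1[of x \<Phi>0 \<Phi>1] x by (simp add: subdivision_map_def)
  show "normalize_sum (level_map \<Phi>0 \<Phi>1 (fst (0, x)) (snd (0, x))) = subdivision_map \<Phi>0 x"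
    using level_map_0[of x \<Phi>0 \<Phi>1] x by (simp add: subdivision_map_def)
qed

section \<open>Push-forward and fibrewise maximum\<close>

lemma induced_map_eq_sum:
  assumes "finite \<sigma>" "spt x \<subseteq> \<sigma>"
  shows "induced_map f x w = (\<Sum>v\<in>\<sigma>. if f v = w then x v else 0)"
proof -
  have "induced_map f x w = (\<Sum>v\<in>{v\<in>\<sigma>. f v = w}. x v)"
    unfolding induced_map_def using assms by (intro sum.mono_neutral_left) (auto simp: spt_def)
  then show ?thesis
    using assms by (simp add: sum.If_cases Int_def)
qed

lemma spt_induced_map:
  assumes "\<And>v. 0 \<le> x v" "finite (spt x)"
  shows "spt (induced_map f x) = f ` spt x"
proof -
  have "induced_map f x w \<noteq> 0 \<longleftrightarrow> w \<in> f ` spt x" for w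
    unfolding induced_map_eq_sum[OF assms(2) order_refl]
    using assms by (subst sum_nonneg_eq_0_iff) (auto simp: spt_def)
  then show ?thesis
    unfolding spt_def[of "induced_map f x"] by blast
qed

lemma induced_map_nonneg: "(\<And>v. 0 \<le> x v) \<Longrightarrow> 0 \<le> induced_map f x w"
  by (simp add: induced_map_def sum_nonneg)

lemma finitary_induced_map:
  assumes K: "complex_on K" "\<sigma> \<in> K" and f: "simplicial_map K L f"
  shows "finitary (geo_simplex \<sigma>) L (induced_map f)"
proof -
  note fin = complex_onD(1)[OF K]
  have "induced_map f x \<in> geo_simplex (f ` \<sigma>)" if x: "x \<in> geo_simplex \<sigma>" for x
  proof -
    have "(\<Sum>w\<in>f ` \<sigma>. induced_map f x w) = (\<Sum>w\<in>f ` \<sigma>. \<Sum>v\<in>\<sigma>. if f v = w then x v else 0)"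
      by (simp add: induced_map_eq_sum[OF fin spt_geo_simplex(1)[OF x]])
    also have "\<dots> = (\<Sum>v\<in>\<sigma>. \<Sum>w\<in>f ` \<sigma>. if f v = w then x v else 0)"
      by (rule sum.swap)
    also have "\<dots> = (\<Sum>v\<in>\<sigma>. x v)"
      using fin by (intro sum.cong refl) (simp add: sum.delta)
    finally have "sum (induced_map f x) (f ` \<sigma>) = 1"
      using x by (simp add: geo_simplex_def)
    moreover have "spt (induced_map f x) \<subseteq> f ` \<sigma>"
      using spt_induced_map[of x f] fin spt_geo_simplex(1)[OF x] geo_simplex_nonneg[OF x]
      by (metis finite_subset image_mono)
    ultimately show ?thesis
      using induced_map_nonneg[where x=x and f=f, OF geo_simplex_nonneg[OF x]]
      by (auto simp: geo_simplex_def spt_def)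
  qed
  then have "induced_map f ` geo_simplex \<sigma> \<subseteq> complex_space {\<tau>\<in>L. \<tau> \<subseteq> f ` \<sigma>}"
    using f K unfolding simplicial_map_def complex_space_def by blast
  moreover have "continuous_on (geo_simplex \<sigma>) (\<lambda>x. induced_map f x w)" for w
  proof (rule continuous_on_eq)
    show "continuous_on (geo_simplex \<sigma>) (\<lambda>x. \<Sum>v\<in>\<sigma>. if f v = w then x v else 0)"
      by (intro continuous_on_sum continuous_on_if_zero
          continuous_on_subset[OF continuous_on_product_coordinates] subset_UNIV)
  qed (simp add: induced_map_eq_sum[OF fin spt_geo_simplex(1)])
  ultimately show ?thesis
    using fin unfolding finitary_def by blast
qed

text \<open>Unlike those of the push-forward, the superlevel sets of the fibrewise maximum are images of
  superlevel sets.\<close>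

definition fibre_max :: "('a \<Rightarrow> 'b) \<Rightarrow> ('a \<Rightarrow> real) \<Rightarrow> 'b \<Rightarrow> real" where
  "fibre_max f x w = Max (insert 0 (x ` {v \<in> spt x. f v = w}))"

lemma fibre_max_nonneg: "finite (spt x) \<Longrightarrow> 0 \<le> fibre_max f x w"
  by (simp add: fibre_max_def)

lemma le_fibre_max_iff:
  assumes "finite (spt x)" "0 < \<alpha>"
  shows "\<alpha> \<le> fibre_max f x w \<longleftrightarrow> (\<exists>v. f v = w \<and> \<alpha> \<le> x v)"
  using assms unfolding fibre_max_def by (subst Max_ge_iff) (fastforce simp: spt_def)+

lemma spt_fibre_max:
  assumes "\<And>v. 0 \<le> x v" "finite (spt x)"
  shows "spt (fibre_max f x) = f ` spt x"
proof -
  have "fibre_max f x w \<noteq> 0 \<longleftrightarrow> 0 < fibre_max f x w" for w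
    using fibre_max_nonneg[OF assms(2), of f w] by auto
  also have "0 < fibre_max f x w \<longleftrightarrow> (\<exists>v\<in>spt x. f v = w \<and> 0 < x v)" for w
    using assms(2) unfolding fibre_max_def by (subst Max_gr_iff) auto
  finally show ?thesis
    using assms(1) by (auto simp: spt_def less_le image_iff)
qed

lemma superlevels_fibre_max:
  assumes "finite (spt x)"
  shows "superlevels (fibre_max f x) \<subseteq> (`) f ` superlevels x"
proof
  fix \<tau> assume "\<tau> \<in> superlevels (fibre_max f x)"
  then obtain \<alpha> where \<alpha>: "0 < \<alpha>" "\<tau> = {w. \<alpha> \<le> fibre_max f x w}" "\<tau> \<noteq> {}"
    by (auto simp: superlevels_def)
  have "\<tau> = f ` {v. \<alpha> \<le> x v}"
    unfolding \<alpha>(2) by (auto simp: le_fibre_max_iff[OF assms \<alpha>(1)])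
  then show "\<tau> \<in> (`) f ` superlevels x"
    using \<alpha> by (auto simp: superlevels_def)
qed

text \<open>Division by a positive constant only rescales the thresholds.\<close>

lemma superlevels_normalize_sum:
  assumes "\<And>v. 0 \<le> h v" "finite (spt h)" "spt h \<noteq> {}"
  shows "superlevels (normalize_sum h) \<subseteq> superlevels h"
proof
  fix \<tau> assume "\<tau> \<in> superlevels (normalize_sum h)"
  then obtain \<alpha> where \<alpha>: "0 < \<alpha>" "\<tau> = {w. \<alpha> \<le> normalize_sum h w}" "\<tau> \<noteq> {}"
    by (auto simp: superlevels_def)
  moreover have "0 < sum h (spt h)"
    by (rule sum_spt_pos[OF assms])
  ultimately show "\<tau> \<in> superlevels h"
    unfolding superlevels_def
    by (auto simp: normalize_sum_def pos_le_divide_eq intro!: exI[of _ "\<alpha> * sum h (spt h)"])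
qed

lemma finitary_fibre_max:
  assumes K: "complex_on K" "\<sigma> \<in> K" and L: "complex_on L" and f: "simplicial_map K L f"
  shows "finitary (geo_simplex \<sigma>) L (\<lambda>x. normalize_sum (fibre_max f x))"
proof (rule finitary_normalize_sum[OF L])
  note fin = complex_onD(1)[OF K]
  show "finite (f ` \<sigma>)"
    using fin by simp
  fix x assume x: "x \<in> geo_simplex \<sigma>"
  then have fx: "finite (spt x)"
    using spt_geo_simplex(1) fin finite_subset by blast
  then show "0 \<le> fibre_max f x v" for v
    by (rule fibre_max_nonneg)
  have spt: "spt (fibre_max f x) = f ` spt x"
    by (rule spt_fibre_max[OF geo_simplex_nonneg[OF x] fx])
  then show "spt (fibre_max f x) \<subseteq> f ` \<sigma>"
    using spt_geo_simplex(1)[OF x] by auto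
  have "spt x \<in> K"
    using complex_onD(3)[OF K] spt_geo_simplex[OF x] by blast
  then show "spt (fibre_max f x) \<in> L"
    using f spt by (simp add: simplicial_map_def)
next
  fix w
  note fin = complex_onD(1)[OF K]
  show "continuous_on (geo_simplex \<sigma>) (\<lambda>x. fibre_max f x w)"
  proof (rule continuous_on_eq)
    show "continuous_on (geo_simplex \<sigma>) (\<lambda>x. Max (insert 0 ((\<lambda>v. x v) ` {v\<in>\<sigma>. f v = w})))"
      using fin by (intro continuous_on_Max_image[where f="\<lambda>v x. x v"]
          continuous_on_subset[OF continuous_on_product_coordinates] subset_UNIV) auto
    fix x assume x: "x \<in> geo_simplex \<sigma>"
    have "insert 0 (x ` {v \<in> spt x. f v = w}) = insert 0 (x ` {v\<in>\<sigma>. f v = w})"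
      using spt_geo_simplex(1)[OF x] by (auto simp: spt_def image_iff)
    then show "Max (insert 0 ((\<lambda>v. x v) ` {v\<in>\<sigma>. f v = w})) = fibre_max f x w"
      by (simp add: fibre_max_def)
  qed
qed

text \<open>The homotopy inverse is \<open>subdivision_map \<phi>\<close>, well defined because
  nested faces of \<open>L\<close> have adjacent values in the flag complex \<open>K\<close>. The
  condition \<open>f (\<phi> \<tau>) \<in> \<tau>\<close> makes one composite contiguous to the
  identity; \<mu> links the other one to the identity through vertices of the faces
  themselves.\<close>

theorem homotopy_equivalence_induced_map:
  fixes K :: "'a set set" and L :: "'b set set"
  assumes K: "complex_on K" "flag_complex K" and L: "complex_on L" and f: "simplicial_map K L f"
    and \<phi>: "\<And>\<tau>. \<tau> \<in> L \<Longrightarrow> f (\<phi> \<tau>) \<in> \<tau>"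
      "\<And>\<tau> \<tau>'. \<tau> \<in> L \<Longrightarrow> \<tau>' \<in> L \<Longrightarrow> \<tau> \<subseteq> \<tau>' \<Longrightarrow> {\<phi> \<tau>, \<phi> \<tau>'} \<in> K"
    and \<mu>: "\<And>\<sigma>. \<sigma> \<in> K \<Longrightarrow> \<mu> \<sigma> \<in> \<sigma>"
      "\<And>\<sigma> \<sigma>'. \<sigma> \<in> K \<Longrightarrow> \<sigma>' \<in> K \<Longrightarrow> \<sigma> \<subseteq> \<sigma>' \<Longrightarrow> {\<phi> (f ` \<sigma>), \<mu> \<sigma>'} \<in> K"
  shows "homotopy_equivalence (realization K) (realization L) (induced_map f)"
proof -
  let ?g = "subdivision_map \<phi>" and ?m = "\<lambda>x. normalize_sum (fibre_max f x)"
  let ?p = "subdivision_map (\<lambda>\<sigma>. \<phi> (f ` \<sigma>))"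
  have Kx: "\<And>v. 0 \<le> x v" "finite (spt x)" "spt x \<noteq> {}" "spt x \<in> K" if "x \<in> complex_space K" for x
    using that complex_onD(1,2)[OF K(1)] by (auto simp: complex_space_iff[OF K(1)])
  have Lx: "\<And>v. 0 \<le> x v" "finite (spt x)" "spt x \<noteq> {}" "spt x \<in> L" if "x \<in> complex_space L" for x
    using that complex_onD(1,2)[OF L] by (auto simp: complex_space_iff[OF L])
  have fK: "f ` \<sigma> \<in> L" if "\<sigma> \<in> K" for \<sigma>
    using f that by (simp add: simplicial_map_def)
  note fin_f = finitary_induced_map[OF K(1) _ f]
  note fin_m = finitary_fibre_max[OF K(1) _ L f]
  have fin_g: "finitary (geo_simplex \<sigma>) K ?g" if "\<sigma> \<in> L" for \<sigma>
    by (rule finitary_subdivision_map[OF K(2,1) L that \<phi>(2)])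
  have \<mu>2: "{\<mu> \<sigma>, \<mu> \<sigma>'} \<in> K" if "\<sigma> \<in> K" "\<sigma>' \<in> K" "\<sigma> \<subseteq> \<sigma>'" for \<sigma> \<sigma>'
    using \<mu>(1)[OF that(1)] \<mu>(1)[OF that(2)] that(3) by (intro complex_onD(3)[OF K(1) that(2)]) auto
  have \<phi>f: "{\<phi> (f ` \<sigma>), \<phi> (f ` \<sigma>')} \<in> K" if "\<sigma> \<in> K" "\<sigma>' \<in> K" "\<sigma> \<subseteq> \<sigma>'" for \<sigma> \<sigma>'
    using that fK by (intro \<phi>(2) image_mono)
  have fin_p: "finitary (geo_simplex \<sigma>) K ?p" if "\<sigma> \<in> K" for \<sigma>
    by (rule finitary_subdivision_map[OF K(2,1) K(1) that \<phi>f])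
  have fin_\<mu>: "finitary (geo_simplex \<sigma>) K (subdivision_map \<mu>)" if "\<sigma> \<in> K" for \<sigma>
    by (rule finitary_subdivision_map[OF K(2,1) K(1) that \<mu>2])
  have cont_f: "continuous_map (realization K) (realization L) (induced_map f)"
    by (rule continuous_map_realization[OF fin_f])
  have cont_g: "continuous_map (realization L) (realization K) ?g"
    by (rule continuous_map_realization[OF fin_g])
  have spt_m: "spt (?m x) = f ` spt x" if "x \<in> complex_space K" for x
    using Kx[OF that] spt_fibre_max[of x f]
    by (subst spt_normalize_sum) (auto simp: fibre_max_nonneg)

  have "homotopic_with (\<lambda>x. True) (realization L) (realization L) (induced_map f \<circ> ?g) id"
  proof (rule homotopic_straight_line[OF L L])
    show "finitary (geo_simplex \<sigma>) L (induced_map f \<circ> ?g)" if "\<sigma> \<in> L" for \<sigma>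
      by (rule finitary_comp_finitary[OF fin_g[OF that] fin_f])
    show "finitary (geo_simplex \<sigma>) L id" if "\<sigma> \<in> L" for \<sigma>
      using complex_onD(1)[OF L that] that by (rule finitary_id)
    fix x assume x: "x \<in> complex_space L"
    have g: "?g x \<in> complex_space K"
      using cont_g x unfolding continuous_map by auto
    have "spt ((induced_map f \<circ> ?g) x) = f ` spt (?g x)"
      using spt_induced_map[of "?g x" f] Kx[OF g] by simp
    also have "\<dots> = f ` \<phi> ` superlevels x"
      using spt_subdivision_map[of x \<phi>] Lx[OF x] by simp
    \<comment> \<open>Each superlevel set lies in the support and contains the image of its chosen
      vertex, so the composite never leaves the carrier of \<open>x\<close>.\<close>
    also have "\<dots> \<subseteq> spt x"
    proof -
      have "\<tau> \<in> L" if "\<tau> \<in> superlevels x" for \<tau>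
        using that superlevels_subset_spt[OF that] complex_onD(3)[OF L Lx(4)[OF x]]
        by (auto simp: superlevels_def)
      then show ?thesis
        using \<phi>(1) superlevels_subset_spt[of _ x] by blast
    qed
    finally show "spt ((induced_map f \<circ> ?g) x) \<union> spt (id x) \<in> L"
      using Lx(4)[OF x] by (simp add: Un_absorb1)
  qed
  moreover have "homotopic_with (\<lambda>x. True) (realization K) (realization K) (?g \<circ> induced_map f) id"
  proof -
    \<comment> \<open>The push-forward and the fibrewise maximum have the same support, so the
      segment between them stays in a face.\<close>
    have "homotopic_with (\<lambda>x. True) (realization K) (realization L) (induced_map f) ?m"
    proof (rule homotopic_straight_line[OF K(1) L fin_f fin_m])
      fix x assume x: "x \<in> complex_space K"
      show "spt (induced_map f x) \<union> spt (?m x) \<in> L"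
        using spt_m[OF x] spt_induced_map[of x f] Kx[OF x] fK by simp
    qed
    then have "homotopic_with (\<lambda>x. True) (realization K) (realization K) (?g \<circ> induced_map f) (?g \<circ> ?m)"
      by (rule homotopic_with_compose_continuous_map_left[OF _ cont_g]) simp
    moreover have "homotopic_with (\<lambda>x. True) (realization K) (realization K) (?g \<circ> ?m) ?p"
    proof (rule homotopic_straight_line[OF K(1) K(1) _ fin_p])
      show "finitary (geo_simplex \<sigma>) K (?g \<circ> ?m)" if "\<sigma> \<in> K" for \<sigma>
        by (rule finitary_comp_finitary[OF fin_m[OF that] fin_g])
      fix x assume x: "x \<in> complex_space K"
      obtain \<sigma> where \<sigma>: "\<sigma> \<in> K" "x \<in> geo_simplex \<sigma>"
        using x by (auto simp: complex_space_def)
      have m: "?m x \<in> complex_space L"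
        by (rule finitary_imp_complex_space[OF fin_m[OF \<sigma>(1)] \<sigma>(2)])
      have p: "?p x \<in> complex_space K"
        by (rule finitary_imp_complex_space[OF fin_p[OF \<sigma>(1)] \<sigma>(2)])
      have "superlevels (?m x) \<subseteq> superlevels (fibre_max f x)"
        using Kx[OF x] spt_fibre_max[of x f]
        by (intro superlevels_normalize_sum) (auto simp: fibre_max_nonneg)
      then have "superlevels (?m x) \<subseteq> (`) f ` superlevels x"
        using superlevels_fibre_max[OF Kx(2)[OF x], of f] by simp
      \<comment> \<open>Superlevel sets of \<open>?m x\<close> are images of superlevel sets of
        \<open>x\<close>, so the values of \<phi> on them are already vertices of the carrier of
        \<open>?p x\<close>.\<close>
      then have "spt (?g (?m x)) \<subseteq> spt (?p x)"
        using spt_subdivision_map[of "?m x" \<phi>] Lx[OF m]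
          spt_subdivision_map[of x "\<lambda>\<sigma>. \<phi> (f ` \<sigma>)"] Kx[OF x] by auto
      then show "spt ((?g \<circ> ?m) x) \<union> spt (?p x) \<in> K"
        using Kx(4)[OF p] by (simp add: Un_absorb1)
    qed
    \<comment> \<open>The prism between the two families; the second assumption on \<mu> supplies
      its mixed edges.\<close>
    moreover have "homotopic_with (\<lambda>x. True) (realization K) (realization K) ?p (subdivision_map \<mu>)"
      using \<phi>f \<mu>2 \<mu>(2) by (rule homotopic_subdivision_maps[OF K(2,1) K(1)])
    moreover have "homotopic_with (\<lambda>x. True) (realization K) (realization K) (subdivision_map \<mu>) id"
    proof (rule homotopic_straight_line[OF K(1) K(1) fin_\<mu>])
      show "finitary (geo_simplex \<sigma>) K id" if "\<sigma> \<in> K" for \<sigma>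
        using complex_onD(1)[OF K(1) that] that by (rule finitary_id)
      fix x assume x: "x \<in> complex_space K"
      have "\<tau> \<in> K" if "\<tau> \<in> superlevels x" for \<tau>
        using that superlevels_subset_spt[OF that] complex_onD(3)[OF K(1) Kx(4)[OF x]]
        by (auto simp: superlevels_def)
      then have "\<mu> ` superlevels x \<subseteq> spt x"
        using \<mu>(1) superlevels_subset_spt[of _ x] by blast
      then show "spt (subdivision_map \<mu> x) \<union> spt (id x) \<in> K"
        using spt_subdivision_map[of x \<mu>] Kx[OF x] by (simp add: Un_absorb1)
    qed
    ultimately show ?thesis
      by (meson homotopic_with_trans)
  qed
  ultimately show ?thesis
    unfolding homotopy_equivalence_def using cont_f cont_g by blast
qed

section \<open>Arcs on the circle\<close>

text \<open>Adjacency in the Vietoris--Rips complex, in coordinates stretched by the factor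
  \<open>1 + 2 * r\<close>.\<close>

definition near :: "real \<Rightarrow> real \<Rightarrow> real \<Rightarrow> bool" where
  "near r u v \<longleftrightarrow> \<bar>u - v\<bar> \<le> 2 * r \<or> 1 \<le> \<bar>u - v\<bar>"

text \<open>Points from which an arc of length \<open>2 * r\<close> runs to 0 or beyond and covers
  the face: it contains what lies from \<open>a\<close> on and, after wrapping, what lies up to
  \<open>a + 2 * r - 1\<close>.\<close>

definition wrap_starts :: "real \<Rightarrow> real set \<Rightarrow> real set" where
  "wrap_starts r \<tau> = {a \<in> \<tau>. 1 - 2 * r \<le> a \<and> (\<forall>x\<in>\<tau>. a \<le> x \<or> x \<le> a + 2 * r - 1)}"

text \<open>The first point of an arc of length \<open>2 * r\<close> containing the face, lifted to stretched
  coordinates. The lift by 1 of faces below \<open>2 * r\<close>, and the maximal choice of a start for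
  faces that wrap around 0, are what makes nested faces have adjacent starts.\<close>

definition arc_start :: "real \<Rightarrow> real set \<Rightarrow> real" where
  "arc_start r \<tau> = (if \<tau> \<subseteq> {..<2 * r} then Min \<tau> + 1
     else if Max \<tau> - Min \<tau> \<le> 2 * r then Min \<tau> else Max (wrap_starts r \<tau>))"

section \<open>Stretched coordinates on the circle\<close>

lemma near_commute: "near r u v \<longleftrightarrow> near r v u"
  by (auto simp: near_def)

text \<open>Stretching makes the circumference \<open>1 + 2 * r\<close>, so the way round through 0
  has length at most \<open>2 * r\<close> exactly when the direct difference is at least 1.\<close>

lemma s1_dist_scaled_le_iff:
  assumes "0 < r"
  shows "s1_dist x y \<le> 2 * r / (1 + 2 * r) \<longleftrightarrow> near r ((1 + 2 * r) * x) ((1 + 2 * r) * y)"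
proof -
  have "\<bar>(1 + 2 * r) * x - (1 + 2 * r) * y\<bar> = (1 + 2 * r) * \<bar>x - y\<bar>"
    using assms by (simp add: right_diff_distrib[symmetric] abs_mult)
  moreover have "d \<le> 2 * r / (1 + 2 * r) \<longleftrightarrow> (1 + 2 * r) * d \<le> 2 * r"
    "1 - d \<le> 2 * r / (1 + 2 * r) \<longleftrightarrow> 1 \<le> (1 + 2 * r) * d" for d
    using assms pos_le_divide_eq[of "1 + 2 * r" d "2 * r"] pos_le_divide_eq[of "1 + 2 * r" "1 - d" "2 * r"]
    by (auto simp: algebra_simps)
  ultimately show ?thesis
    unfolding near_def s1_dist_def min_le_iff_disj by simp
qed

text \<open>Points of the circle are at most 1/2 apart, which settles lifts differing by 1/2 or
  more. For closer lifts the integer parts differ by at most 1, and the minimum in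
  \<open>s1_dist\<close> allows for both ways round.\<close>

lemma s1_dist_frac_le: "s1_dist (frac u) (frac v) \<le> \<bar>u - v\<bar>"
proof (cases "\<bar>u - v\<bar> < 1/2")
  case False
  then show ?thesis
    unfolding s1_dist_def by linarith
next
  case True
  define k where "k = \<lfloor>u\<rfloor> - \<lfloor>v\<rfloor>"
  have eq: "frac u - frac v = u - v - of_int k"
    by (simp add: frac_def k_def)
  have "\<bar>frac u - frac v\<bar> < 1"
    using frac_lt_1[of u] frac_lt_1[of v] frac_ge_0[of u] frac_ge_0[of v] by linarith
  then have "\<bar>real_of_int k\<bar> < 2"
    using True eq by linarith
  then have "k = -1 \<or> k = 0 \<or> k = 1"
    by linarith
  then show ?thesis
    using eq True unfolding s1_dist_def by (elim disjE) auto
qed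

text \<open>Both copies lie in [0,1) after division by \<open>1 + 2 * r\<close>, so
  \<open>frac\<close> leaves them unchanged. The strict bound in the second alternative encodes that
  only points below \<open>2 * r\<close> are copied.\<close>

lemma T_r_iff:
  assumes "X \<subseteq> S1" "0 < r"
  shows "y \<in> T_r r X \<longleftrightarrow> (1 + 2 * r) * y \<in> X \<or> (1 + 2 * r) * y - 1 \<in> X \<and> (1 + 2 * r) * y < 1 + 2 * r"
proof -
  have 1: "frac (1 / (1 + 2 * r) * x + 0) = x / (1 + 2 * r)" if "x \<in> X" for x
  proof -
    have "0 \<le> x / (1 + 2 * r)" "x / (1 + 2 * r) < 1"
      using assms that by (auto simp: S1_def)
    then show ?thesis
      by (simp add: frac_eq)
  qed
  have 2: "frac (1 / (1 + 2 * r) * x + 1 / (1 + 2 * r)) = (x + 1) / (1 + 2 * r)"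
    if "x \<in> X" "x < 2 * r" for x
  proof -
    have "0 \<le> (x + 1) / (1 + 2 * r)" "(x + 1) / (1 + 2 * r) < 1"
      using assms that by (auto simp: S1_def)
    then show ?thesis
      by (simp add: frac_eq add_divide_distrib)
  qed
  have arc: "X \<inter> s1_arc0 (2 * r) = {x \<in> X. x < 2 * r}"
    using assms by (auto simp: s1_arc0_def)
  have "T_r r X = (\<lambda>x. x / (1 + 2 * r)) ` X \<union> (\<lambda>x. (x + 1) / (1 + 2 * r)) ` {x \<in> X. x < 2 * r}"
    unfolding T_r_def s1_affine_def arc using 1 2 by (intro arg_cong2[of _ _ _ _ "(\<union>)"] image_cong) auto
  moreover have "y = z / (1 + 2 * r) \<longleftrightarrow> (1 + 2 * r) * y = z" for z
    using assms by (auto simp: field_simps)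
  ultimately show ?thesis
    by (auto simp: image_iff algebra_simps intro!: bexI[of _ "y + 2 * (r * y) - 1"])
qed

lemma T_r_scaled_bounds:
  assumes "X \<subseteq> S1" "0 < r" "y \<in> T_r r X"
  shows "0 \<le> (1 + 2 * r) * y" "(1 + 2 * r) * y < 1 + 2 * r"
proof -
  have X: "0 \<le> x \<and> x < 1" if "x \<in> X" for x
    using that assms(1) by (auto simp: S1_def)
  consider "(1 + 2 * r) * y \<in> X" | "(1 + 2 * r) * y - 1 \<in> X" "(1 + 2 * r) * y < 1 + 2 * r"
    using assms T_r_iff by blast
  then have "0 \<le> (1 + 2 * r) * y \<and> (1 + 2 * r) * y < 1 + 2 * r"
    by cases (use X[of "(1 + 2 * r) * y"] X[of "(1 + 2 * r) * y - 1"] assms(2) in linarith)+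
  then show "0 \<le> (1 + 2 * r) * y" "(1 + 2 * r) * y < 1 + 2 * r"
    by auto
qed

lemma pi_r_cases:
  assumes "X \<subseteq> S1" "0 < r" "y \<in> T_r r X"
  obtains "(1 + 2 * r) * y \<in> X" "pi_r r y = (1 + 2 * r) * y"
  | "(1 + 2 * r) * y - 1 \<in> X" "pi_r r y = (1 + 2 * r) * y - 1" "(1 + 2 * r) * y < 1 + 2 * r"
proof -
  consider "(1 + 2 * r) * y \<in> X" | "(1 + 2 * r) * y - 1 \<in> X" "(1 + 2 * r) * y < 1 + 2 * r"
    using assms T_r_iff by blast
  then show ?thesis
  proof cases
    case 1
    then have "frac ((1 + 2 * r) * y) = (1 + 2 * r) * y"
      using assms by (subst frac_eq) (auto simp: S1_def)
    then show ?thesis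
      using 1 that by (simp add: pi_r_def)
  next
    case 2
    then have "frac ((1 + 2 * r) * y - 1) = (1 + 2 * r) * y - 1"
      using assms by (subst frac_eq) (auto simp: S1_def)
    moreover have "frac ((1 + 2 * r) * y - 1) = frac ((1 + 2 * r) * y)"
      by (simp add: frac_def)
    ultimately show ?thesis
      using 2 that by (simp add: pi_r_def)
  qed
qed

lemma pi_r_image_T_r:
  assumes "X \<subseteq> S1" "0 < r"
  shows "pi_r r ` T_r r X = X"
proof
  show "pi_r r ` T_r r X \<subseteq> X"
    by (rule image_subsetI, erule pi_r_cases[OF assms]) simp_all
  show "X \<subseteq> pi_r r ` T_r r X"
  proof
    fix x assume x: "x \<in> X"
    have "(1 + 2 * r) * (x / (1 + 2 * r)) = x"
      using assms by simp
    then have "x / (1 + 2 * r) \<in> T_r r X" "pi_r r (x / (1 + 2 * r)) = x"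
      using x assms by (auto simp: T_r_iff pi_r_def S1_def frac_eq)
    then show "x \<in> pi_r r ` T_r r X"
      by (metis imageI)
  qed
qed

section \<open>The two complexes and the projection between them\<close>

lemma VR_le_iff:
  assumes "0 < r"
  shows "\<sigma> \<in> VR_le Y (2 * r / (1 + 2 * r)) \<longleftrightarrow> \<sigma> \<subseteq> Y \<and> finite \<sigma> \<and> \<sigma> \<noteq> {} \<and>
    (\<forall>x\<in>\<sigma>. \<forall>y\<in>\<sigma>. near r ((1 + 2 * r) * x) ((1 + 2 * r) * y))"
  using assms by (simp add: VR_le_def s1_dist_scaled_le_iff)

lemma complex_on_VR_le: "complex_on (VR_le Y s)"
  unfolding complex_on_def VR_le_def by (auto intro: finite_subset)

lemma complex_on_Cech_le: "complex_on (Cech_le X r)"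
  unfolding complex_on_def Cech_le_def by (auto intro: finite_subset)

lemma flag_complex_VR_le: "flag_complex (VR_le Y s)"
  unfolding flag_complex_def VR_le_def by auto

text \<open>Starting from its smallest stretched coordinate m, a Vietoris--Rips face lies in the
  union of \<open>[m, m + 2r]\<close> and \<open>[m + 1, 1 + 2r)\<close>, and both project into the arc from m to
  \<open>m + 2r\<close>.\<close>

lemma simplicial_map_pi_r:
  assumes X: "X \<subseteq> S1" and r: "0 < r"
  shows "simplicial_map (VR_le (T_r r X) (2 * r / (1 + 2 * r))) (Cech_le X r) (pi_r r)"
  unfolding simplicial_map_def
proof
  fix \<sigma> assume \<sigma>: "\<sigma> \<in> VR_le (T_r r X) (2 * r / (1 + 2 * r))"
  then have sub: "\<sigma> \<subseteq> T_r r X" and fin: "finite \<sigma>" "\<sigma> \<noteq> {}"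
    and nr: "\<And>x y. x \<in> \<sigma> \<Longrightarrow> y \<in> \<sigma> \<Longrightarrow> near r ((1 + 2 * r) * x) ((1 + 2 * r) * y)"
    using VR_le_iff[OF r] by auto
  define m where "m = (1 + 2 * r) * Min \<sigma>"
  have m0: "0 \<le> m"
    unfolding m_def using sub Min_in[OF fin] by (intro T_r_scaled_bounds[OF X r]) auto
  have "s1_dist (pi_r r x) (frac (m + r)) \<le> r" if x: "x \<in> \<sigma>" for x
  proof -
    let ?u = "(1 + 2 * r) * x"
    have "m \<le> ?u"
      using fin x r by (simp add: m_def)
    moreover have "?u < 1 + 2 * r"
      using sub x by (intro T_r_scaled_bounds[OF X r]) auto
    moreover have "near r ?u m"
      using nr[OF x Min_in[OF fin]] by (simp add: m_def)
    ultimately have "\<bar>?u - (m + r)\<bar> \<le> r \<or> \<bar>(?u - 1) - (m + r)\<bar> \<le> r"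
      using m0 by (auto simp: near_def)
    moreover have "frac (?u - 1) = frac ?u"
      by (simp add: frac_def)
    ultimately show ?thesis
      using s1_dist_frac_le[of ?u "m + r"] s1_dist_frac_le[of "?u - 1" "m + r"]
      by (auto simp: pi_r_def)
  qed
  moreover have "frac (m + r) \<in> S1"
    using frac_lt_1 frac_ge_0 by (simp add: S1_def)
  ultimately show "pi_r r ` \<sigma> \<in> Cech_le X r"
    using sub fin pi_r_image_T_r[OF X r] by (auto simp: Cech_le_def)
qed

section \<open>Starting points of arcs\<close>

lemma wrap_starts_nonempty:
  assumes X: "X \<subseteq> S1" and r: "0 < r" "r < 1/2" and \<tau>: "\<tau> \<in> Cech_le X r"
    and spread: "x0 \<in> \<tau>" "y0 \<in> \<tau>" "2 * r < y0 - x0"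
  shows "wrap_starts r \<tau> \<noteq> {}"
proof -
  obtain p where "p \<in> S1" "\<forall>x\<in>\<tau>. s1_dist x p \<le> r"
    using \<tau> unfolding Cech_le_def by blast
  then have p: "0 \<le> p" "p < 1" "\<And>x. x \<in> \<tau> \<Longrightarrow> s1_dist x p \<le> r"
    by (auto simp: S1_def)
  have fin: "finite \<tau>"
    using \<tau> by (auto simp: Cech_le_def)
  have unit: "0 \<le> x \<and> x < 1" if "x \<in> \<tau>" for x
    using that X \<tau> by (auto simp: Cech_le_def S1_def)
  have d: "p - r \<le> x \<and> x \<le> p + r \<or> p + 1 - r \<le> x \<or> x \<le> p - 1 + r" if "x \<in> \<tau>" for x
    using p(3)[OF that] unfolding s1_dist_def by linarith
  \<comment> \<open>Moving the beginning \<open>c\<close> of a covering arc forward to the first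
    point of the face from \<open>c\<close> on loses no point and gives a start inside the
    face.\<close>
  have start: "wrap_starts r \<tau> \<noteq> {}"
    if c: "1 - 2 * r \<le> c" and y: "y \<in> \<tau>" "c \<le> y"
      and gap: "\<And>x. x \<in> \<tau> \<Longrightarrow> c \<le> x \<or> x \<le> c + 2 * r - 1" for c y
  proof -
    let ?a = "Min {x \<in> \<tau>. c \<le> x}"
    have a: "?a \<in> {x \<in> \<tau>. c \<le> x}"
      using fin y by (intro Min_in) auto
    have "?a \<le> x \<or> x \<le> ?a + 2 * r - 1" if "x \<in> \<tau>" for x
    proof (cases "c \<le> x")
      case True
      then show ?thesis
        using fin that by (auto intro!: Min_le)
    next
      case False
      then show ?thesis
        using gap[OF that] a by auto
    qed
    then have "?a \<in> wrap_starts r \<tau>"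
      using a c by (auto simp: wrap_starts_def)
    then show ?thesis
      by blast
  qed
  \<comment> \<open>The arc about \<open>p\<close> begins at \<open>p - r\<close>, read as
    \<open>p + 1 - r\<close> when this is negative. In the other case the spread forces
    \<open>x0\<close> to lie past 0, so \<open>p + r\<close> is at least 1 and the arc
    wraps.\<close>
  show ?thesis
  proof (cases "p < r")
    case True
    have "p + 1 - r \<le> y0"
      using d[OF spread(2)] d[OF spread(1)] unit[OF spread(1)] unit[OF spread(2)] spread(3) True r
      by linarith
    moreover have "p + 1 - r \<le> x \<or> x \<le> p + 1 - r + 2 * r - 1" if "x \<in> \<tau>" for x
      using d[OF that] unit[OF that] True r by linarith
    ultimately show ?thesis
      using True p(1) spread(2) r by (intro start[of "p + 1 - r" y0]) auto
  next
    case False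
    have xp: "x0 \<le> p - 1 + r" and py: "p - r \<le> y0"
      using d[OF spread(2)] d[OF spread(1)] unit[OF spread(1)] unit[OF spread(2)] spread(3) False r p(1,2)
      by linarith+
    have "p - r \<le> x \<or> x \<le> p - r + 2 * r - 1" if "x \<in> \<tau>" for x
      using d[OF that] r by linarith
    then show ?thesis
      using py xp unit[OF spread(1)] spread(2) by (intro start[of "p - r" y0]) auto
  qed
qed

text \<open>Collects for each shape the facts used in comparisons. The point \<open>y\<close> at or
  beyond \<open>2 * r\<close> separates the last two shapes from the first; in the third,
  nonemptiness of \<open>wrap_starts r \<tau>\<close> makes its maximum a member.\<close>

lemma arc_start_cases:
  assumes X: "X \<subseteq> S1" and r: "0 < r" "r < 1/2" and \<tau>: "\<tau> \<in> Cech_le X r"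
  obtains (low) \<mu> where "\<mu> \<in> \<tau>" "\<And>x. x \<in> \<tau> \<Longrightarrow> \<mu> \<le> x \<and> x < 2 * r" "arc_start r \<tau> = \<mu> + 1"
  | (interval) \<mu> y where "\<mu> \<in> \<tau>" "y \<in> \<tau>" "2 * r \<le> y" "\<And>x. x \<in> \<tau> \<Longrightarrow> \<mu> \<le> x \<and> x \<le> \<mu> + 2 * r"
      "arc_start r \<tau> = \<mu>"
  | (wrap) a y where "a \<in> \<tau>" "y \<in> \<tau>" "2 * r \<le> y" "1 - 2 * r \<le> a"
      "\<And>x. x \<in> \<tau> \<Longrightarrow> a \<le> x \<or> x \<le> a + 2 * r - 1"
      "\<And>b. b \<in> wrap_starts r \<tau> \<Longrightarrow> b \<le> a" "arc_start r \<tau> = a"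
proof -
  have fin: "finite \<tau>" "\<tau> \<noteq> {}"
    using \<tau> by (auto simp: Cech_le_def)
  show ?thesis
  proof (cases "\<tau> \<subseteq> {..<2 * r}")
    case True
    then show ?thesis
      using low[of "Min \<tau>"] fin by (auto simp: arc_start_def)
  next
    case not_low: False
    then obtain y where y: "y \<in> \<tau>" "2 * r \<le> y"
      by (meson lessThan_iff not_less subsetI)
    show ?thesis
    proof (cases "Max \<tau> - Min \<tau> \<le> 2 * r")
      case True
      have "Min \<tau> \<le> x \<and> x \<le> Min \<tau> + 2 * r" if "x \<in> \<tau>" for x
        using True that Min_le[OF fin(1) that] Max_ge[OF fin(1) that] by linarith
      then show ?thesis
        using interval[of "Min \<tau>" y] y not_low True fin by (auto simp: arc_start_def)
    next
      case False
      have "wrap_starts r \<tau> \<noteq> {}"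
        using False fin by (intro wrap_starts_nonempty[OF X r \<tau>, of "Min \<tau>" "Max \<tau>"]) auto
      moreover have fw: "finite (wrap_starts r \<tau>)"
        using fin by (simp add: wrap_starts_def)
      ultimately have "Max (wrap_starts r \<tau>) \<in> wrap_starts r \<tau>"
        by (rule Max_in[rotated])
      then show ?thesis
        using wrap[of "Max (wrap_starts r \<tau>)" y] y not_low False fw
        by (auto simp: arc_start_def wrap_starts_def[of r \<tau>, THEN eqset_imp_iff])
    qed
  qed
qed

text \<open>The criterion for membership in \<open>T_r r \<tau>\<close>, with \<tau> in the role of
  \<open>X\<close>. The shift by 1 occurs only for faces below \<open>2 * r\<close>, whence the
  strict bound.\<close>

lemma arc_start_lifts:
  assumes "X \<subseteq> S1" "0 < r" "r < 1/2" "\<tau> \<in> Cech_le X r"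
  shows "arc_start r \<tau> \<in> \<tau> \<or> arc_start r \<tau> - 1 \<in> \<tau> \<and> arc_start r \<tau> < 1 + 2 * r"
  using assms by (rule arc_start_cases) auto

text \<open>If \<tau> lies below \<open>2 * r\<close>, so does \<sigma>, and both starts lie in [1,
  1 + 2r). If \<tau> is an interval from \<mu>, the start of \<sigma> is \<open>x\<close> or
  \<open>x + 1\<close> for a point \<open>x\<close> of \<tau>, at distance at most
  \<open>2 * r\<close> or at least 1 from \<mu>. If \<tau> wraps, its start is at least
  \<open>1 - 2 * r\<close>.\<close>

lemma near_arc_start:
  assumes X: "X \<subseteq> S1" and r: "0 < r" "r < 1/2" and \<tau>: "\<tau> \<in> Cech_le X r" and \<sigma>: "\<sigma> \<in> Cech_le X r"
    and sub: "\<sigma> \<subseteq> \<tau>"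
  shows "near r (arc_start r \<sigma>) (arc_start r \<tau>)"
  using X r \<tau>
proof (cases rule: arc_start_cases)
  case \<tau>1: (low \<mu>)
  have unit: "0 \<le> x" if "x \<in> \<tau>" for x
    using that X \<tau> by (auto simp: Cech_le_def S1_def)
  from X r \<sigma> show ?thesis
  proof (cases rule: arc_start_cases)
    case (low \<nu>)
    then have "\<nu> \<in> \<tau>"
      using sub by auto
    then show ?thesis
      using \<tau>1(2)[of \<nu>] \<tau>1(2)[of \<mu>] \<tau>1(1,3) low(3) unit[of \<nu>] unit[of \<mu>] by (auto simp: near_def)
  next
    case (interval \<nu> y)
    then show ?thesis
      using sub \<tau>1(2)[of y] by auto
  next
    case (wrap a y)
    then show ?thesis
      using sub \<tau>1(2)[of y] by auto
  qed
next
  case (interval \<mu> y)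
  from arc_start_lifts[OF X r \<sigma>] obtain x where "x \<in> \<tau>" "arc_start r \<sigma> = x \<or> arc_start r \<sigma> = x + 1"
    using sub by force
  then show ?thesis
    using interval(4)[of x] interval(5) by (auto simp: near_def)
next
  case \<tau>3: (wrap a y)
  have unit: "0 \<le> x \<and> x < 1" if "x \<in> \<tau>" for x
    using that X \<tau> by (auto simp: Cech_le_def S1_def)
  have a: "0 \<le> a" "a < 1"
    using unit \<tau>3(1) by auto
  from X r \<sigma> show ?thesis
  proof (cases rule: arc_start_cases)
    case (low \<nu>)
    then have "\<nu> \<in> \<tau>"
      using sub by auto
    then show ?thesis
      using \<tau>3(5)[of \<nu>] unit[of \<nu>] a low(3) \<tau>3(7) \<tau>3(4) unfolding near_def by linarith
  next
    case (interval \<nu> z)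
    then have "\<nu> \<in> \<tau>" "z \<in> \<tau>"
      using sub by auto
    \<comment> \<open>As \<open>z\<close> is at least \<open>2 * r\<close>, it exceeds
      \<open>a + 2 * r - 1\<close>; hence \<open>a\<close> is at most \<open>z\<close>, and so at
      most \<open>\<nu> + 2 * r\<close>.\<close>
    then show ?thesis
      using \<tau>3(5)[of \<nu>] \<tau>3(5)[of z] unit[of \<nu>] a interval(3,5) interval(4)[of z] interval(2) \<tau>3(7) \<tau>3(4)
      unfolding near_def by linarith
  next
    case (wrap b z)
    then have bz: "b \<in> \<tau>" "z \<in> \<tau>"
      using sub by auto
    \<comment> \<open>The first point of \<sigma> from \<open>a\<close> on is again a wrapping start
      of \<sigma>, so it is at most the maximal one, \<open>b\<close>. Then
      \<open>1 - 2 * r \<le> a \<le> b < 1\<close> bounds the difference.\<close>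
    have "a \<le> b"
    proof -
      let ?a = "Min {x \<in> \<sigma>. a \<le> x}"
      have "finite \<sigma>"
        using \<sigma> by (simp add: Cech_le_def)
      have "a \<le> z"
        using \<tau>3(5)[OF bz(2)] a wrap(3) by linarith
      then have a': "?a \<in> {x \<in> \<sigma>. a \<le> x}"
        using \<open>finite \<sigma>\<close> wrap(2) by (intro Min_in) auto
      have "?a \<le> x \<or> x \<le> ?a + 2 * r - 1" if "x \<in> \<sigma>" for x
      proof (cases "a \<le> x")
        case True
        then show ?thesis
          using \<open>finite \<sigma>\<close> that by (auto intro!: Min_le)
      next
        case False
        then show ?thesis
          using \<tau>3(5)[of x] that sub a' by auto
      qed
      then have "?a \<in> wrap_starts r \<sigma>"
        using a' \<tau>3(4) by (auto simp: wrap_starts_def)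
      then show ?thesis
        using wrap(6)[of ?a] a' by auto
    qed
    then show ?thesis
      using unit[OF bz(1)] a \<tau>3(4,7) wrap(7) unfolding near_def by linarith
  qed
qed

text \<open>Here \<open>m\<close> is to be the smallest stretched coordinate of a Vietoris--Rips
  face, and \<open>lift\<close> says that each point of \<tau> comes from coordinate
  \<open>x\<close> or \<open>x + 1\<close> of that face. A point \<open>y\<close> at or beyond
  \<open>2 * r\<close> has only its unshifted lift, so \<open>m\<close> is at most \<open>y\<close>;
  this keeps \<open>m\<close> from exceeding the start by more than \<open>2 * r\<close>.\<close>

lemma near_min_arc_start:
  assumes X: "X \<subseteq> S1" and r: "0 < r" "r < 1/2" and \<tau>: "\<tau> \<in> Cech_le X r" and m: "0 \<le> m"
    and lift: "\<And>x. x \<in> \<tau> \<Longrightarrow> m \<le> x \<and> near r m x \<or> x < 2 * r \<and> m \<le> x + 1 \<and> near r m (x + 1)"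
  shows "near r m (arc_start r \<tau>)"
  using X r \<tau>
proof (cases rule: arc_start_cases)
  case (low \<mu>)
  then show ?thesis
    using lift[of \<mu>] by (auto simp: near_def)
next
  case (interval \<mu> y)
  show ?thesis
    using lift[OF interval(1)] lift[OF interval(2)] interval(3,5) interval(4)[OF interval(2)] m
    unfolding near_def by linarith
next
  case (wrap a y)
  have "y < 1"
    using wrap(2) X \<tau> by (auto simp: Cech_le_def S1_def)
  then show ?thesis
    using lift[OF wrap(1)] lift[OF wrap(2)] wrap(3,4,7) m
    unfolding near_def by linarith
qed

theorem theorem9p3:
  fixes X :: "real set" and r :: real
  assumes "X \<subseteq> S1" and "0 < r" and "r < 1/2"
  shows "pi_r r ` T_r r X = X
         \<and> simplicial_map (VR_le (T_r r X) (2*r / (1 + 2*r))) (Cech_le X r) (pi_r r)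
         \<and> homotopy_equivalence (realization (VR_le (T_r r X) (2*r / (1 + 2*r))))
                                (realization (Cech_le X r)) (induced_map (pi_r r))"
proof (intro conjI)
  let ?K = "VR_le (T_r r X) (2*r / (1 + 2*r))" and ?L = "Cech_le X r"
  let ?\<phi> = "\<lambda>\<tau>. arc_start r \<tau> / (1 + 2 * r)"
  show "pi_r r ` T_r r X = X"
    using assms by (intro pi_r_image_T_r)
  show simp: "simplicial_map ?K ?L (pi_r r)"
    using assms by (intro simplicial_map_pi_r)
  have scale: "(1 + 2 * r) * ?\<phi> \<tau> = arc_start r \<tau>" for \<tau>
    using assms by simp
  have \<phi>T: "?\<phi> \<tau> \<in> T_r r X" if "\<tau> \<in> ?L" for \<tau>
    unfolding T_r_iff[OF assms(1,2)] scale
    using arc_start_lifts[OF assms that] that by (auto simp: Cech_le_def)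
  show "homotopy_equivalence (realization ?K) (realization ?L) (induced_map (pi_r r))"
  proof (rule homotopy_equivalence_induced_map[OF complex_on_VR_le flag_complex_VR_le
        complex_on_Cech_le simp, where \<phi>="?\<phi>" and \<mu>=Min])
    fix \<tau> assume \<tau>: "\<tau> \<in> ?L"
    then have \<tau>S: "\<tau> \<subseteq> S1"
      using assms by (auto simp: Cech_le_def)
    \<comment> \<open>Using \<tau> itself in the role of \<open>X\<close> shows that the lift
      projects into \<tau>, not merely into \<open>X\<close>.\<close>
    have "?\<phi> \<tau> \<in> T_r r \<tau>"
      unfolding T_r_iff[OF \<tau>S assms(2)] scale by (rule arc_start_lifts[OF assms \<tau>])
    then show "pi_r r (?\<phi> \<tau>) \<in> \<tau>"
      using pi_r_image_T_r[OF \<tau>S assms(2)] by blast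
  next
    fix \<tau> \<tau>' assume "\<tau> \<in> ?L" "\<tau>' \<in> ?L" "\<tau> \<subseteq> \<tau>'"
    then have "near r (arc_start r \<tau>) (arc_start r \<tau>')"
      by (intro near_arc_start[OF assms])
    then show "{?\<phi> \<tau>, ?\<phi> \<tau>'} \<in> ?K"
      unfolding VR_le_iff[OF assms(2)] using \<phi>T \<open>\<tau> \<in> ?L\<close> \<open>\<tau>' \<in> ?L\<close> assms
      by (auto simp: scale near_commute near_def)
  next
    fix \<sigma> assume "\<sigma> \<in> ?K"
    then show "Min \<sigma> \<in> \<sigma>"
      by (auto simp: VR_le_def)
  next
    fix \<sigma> \<sigma>' assume \<sigma>: "\<sigma> \<in> ?K" "\<sigma>' \<in> ?K" "\<sigma> \<subseteq> \<sigma>'"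
    let ?m = "(1 + 2 * r) * Min \<sigma>'"
    have \<sigma>': "finite \<sigma>'" "\<sigma>' \<noteq> {}" "\<sigma>' \<subseteq> T_r r X"
      and nr: "\<And>x y. x \<in> \<sigma>' \<Longrightarrow> y \<in> \<sigma>' \<Longrightarrow> near r ((1 + 2 * r) * x) ((1 + 2 * r) * y)"
      using \<sigma>(2) VR_le_iff[OF assms(2)] by auto
    have min: "Min \<sigma>' \<in> \<sigma>'"
      using \<sigma>' by simp
    have \<tau>: "pi_r r ` \<sigma> \<in> ?L"
      using simp \<sigma>(1) by (simp add: simplicial_map_def)
    have "near r ?m (arc_start r (pi_r r ` \<sigma>))"
    proof (rule near_min_arc_start[OF assms \<tau>])
      show "0 \<le> ?m"
        using min \<sigma>'(3) by (intro T_r_scaled_bounds[OF assms(1,2)]) auto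
    next
      fix x assume "x \<in> pi_r r ` \<sigma>"
      then obtain y where y: "y \<in> \<sigma>'" "y \<in> T_r r X" "x = pi_r r y"
        using \<sigma> \<sigma>' by blast
      have "?m \<le> (1 + 2 * r) * y" "near r ?m ((1 + 2 * r) * y)"
        using \<sigma>'(1) y assms nr[OF min y(1)] by auto
      then show "?m \<le> x \<and> near r ?m x \<or> x < 2 * r \<and> ?m \<le> x + 1 \<and> near r ?m (x + 1)"
        using y(3) by (cases rule: pi_r_cases[OF assms(1,2) y(2)]) auto
    qed
    moreover have "Min \<sigma>' \<in> T_r r X"
      using min \<sigma>'(3) by auto
    ultimately show "{?\<phi> (pi_r r ` \<sigma>), Min \<sigma>'} \<in> ?K"
      unfolding VR_le_iff[OF assms(2)] using \<phi>T[OF \<tau>] assms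
      by (auto simp: scale near_commute near_def)
  qed
qed

end
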